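(* Let $\chi$ be an indecomposable character of $G_{\widehat{\mathbf n}}$ and let $(\pi_\chi,\mathcal H_\chi,\xi_\chi)$ be the associated Gelfand--Naimark--Segal (GNS) representation. Define the injective homomorphism $\Gamma: G_{\widehat{\mathbf n}}\to G_{\widehat{\mathbf n}}\times G_{\widehat{\mathbf n}}$ by $\Gamma(\mathfrak t s)=(\mathfrak t s,s)$ for $\mathfrak t\in\mathcal F_{\widehat{\mathbf n}}(\mathbb T)$, $s\in\mathfrak S_{\widehat{\mathbf n}}$, and let $\pi=\pi_\chi^{(2)}\circ\Gamma$. Then the restriction of $\pi$ to the closed linear span $[\pi_\chi(\mathcal F_{\widehat{\mathbf n}}(\mathbb T))\xi_\chi]$ is an irreducible $\mathfrak S_{\widehat{\mathbf n}}$-spherical representation of $G_{\widehat{\mathbf n}}$. Moreover, the restrictions to $\mathcal F_{\widehat{\mathbf n}}(\mathbb T)$ of $\chi$ and of the spherical function of this restricted representation coincide.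
   Context: Fix a sequence $\widehat{\mathbf n}=\{n_k\}_{k\ge 1}$ of integers $n_k>1$ and put $N_k=n_1\cdots n_k$. For $N\ge1$ let $\mathbb X_N=\{1,\ldots,N\}$, let $\mathfrak S_N$ be the group of permutations of $\mathbb X_N$, let $\mathbb T=\{z\in\mathbb C:|z|=1\}$, and let $\mathcal F_N(\mathbb T)\simeq\mathbb T^N$ be the group of functions $\mathbb X_N\to\mathbb T$ under pointwise multiplication, with the torus topology. Let $G_N=\mathcal F_N(\mathbb T)\rtimes\mathfrak S_N$ be the set of pairs $(\mathfrak t,\sigma)=\mathfrak t\sigma$ with product topology and multiplication $(\mathfrak t_1,\sigma_1)(\mathfrak t_2,\sigma_2)=(\mathfrak t_1\cdot(\mathfrak t_2\circ\sigma_1^{-1}),\sigma_1\sigma_2)$. The block-diagonal embedding $G_N\to G_{MN}$ sends $(\mathfrak t,\sigma)$ to $(\tilde{\mathfrak t},\tilde\sigma)$, where $\tilde{\mathfrak t}(Nq+r)=\mathfrak t(r)$ and $\tilde\sigma(Nq+r)=Nq+\sigma(r)$ for $0\le q\le M-1$, $1\le r\le N$. $\mathcal F_{\widehat{\mathbf n}}(\mathbb T)$, $\mathfrak S_{\widehat{\mathbf n}}$ and $G_{\widehat{\mathbf n}}$ are the inductive limits (unions) of $\mathcal F_{N_k}(\mathbb T)$, $\mathfrak S_{N_k}$, $G_{N_k}$ along these embeddings $G_{N_k}\to G_{N_{k+1}}$, with the inductive limit topology. A character of a topological group $G$ is a continuous positive-definite function $\chi:G\to\mathbb C$ with $\chi(gh)=\chi(hg)$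 and $\chi(1_G)=1$; it is indecomposable if it is not of the form $\alpha\chi_1+(1-\alpha)\chi_2$ with $\alpha\in(0,1)$ and $\chi_1\ne\chi_2$ characters. For an indecomposable character $\chi$ with GNS representation $(\pi_\chi,\mathcal H_\chi,\xi_\chi)$ (so $\xi_\chi$ is a cyclic unit vector and $\chi(g)=\langle\pi_\chi(g)\xi_\chi,\xi_\chi\rangle$), let $\pi_\chi(G)''$ be the generated von Neumann algebra and let $S:\mathcal H_\chi\to\mathcal H_\chi$ be the antilinear involutive isometry determined by $S(b\xi_\chi)=b^*\xi_\chi$ for $b\in\pi_\chi(G)''$; it satisfies $S\pi_\chi(G)''S=\pi_\chi(G)'$. The formula $\pi_\chi^{(2)}(g_1,g_2)=\pi_\chi(g_1)S\pi_\chi(g_2)S$ defines a unitary representation of $G\times G$ in $\mathcal H_\chi$. A unitary representation $\Pi$ of $G_{\widehat{\mathbf n}}$ in $\mathcal H$ is $\mathfrak S_{\widehat{\mathbf n}}$-spherical if it is irreducible and the space of $\mathfrak S_{\widehat{\mathbf n}}$-invariant vectors is one-dimensional; its spherical function is $g\mapsto\langle\Pi(g)\eta,\eta\rangle$ for a unit $\mathfrak S_{\widehat{\mathbf n}}$-invariant vector $\eta$. *)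

theory Defs
  imports "HOL-Analysis.Analysis" "HOL-Algebra.Group" "HOL-Combinatorics.Permutations"
begin

section \<open>Complex Hilbert spaces\<close>

text \<open>The inner product is linear in the first argument.\<close>

class complex_inner = real_normed_vector +
  fixes scaleC :: "complex \<Rightarrow> 'a \<Rightarrow> 'a" and cinner :: "'a \<Rightarrow> 'a \<Rightarrow> complex"
  assumes scaleC_add_right: "scaleC a (x + y) = scaleC a x + scaleC a y"
    and scaleC_add_left: "scaleC (a + b) x = scaleC a x + scaleC b x"
    and scaleC_scaleC: "scaleC a (scaleC b x) = scaleC (a * b) x"
    and scaleC_one: "scaleC 1 x = x"
    and scaleR_scaleC: "scaleR r x = scaleC (complex_of_real r) x"
    and cinner_commute: "cinner x y = cnj (cinner y x)"
    and cinner_add_left: "cinner (x + y) z = cinner x z + cinner y z"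
    and cinner_scaleC_left: "cinner (scaleC c x) y = c * cinner x y"
    and cinner_self: "cinner x x = complex_of_real ((norm x)\<^sup>2)"

class complex_hilbert = complex_inner + complete_space

instantiation complex :: complex_hilbert
begin
definition scaleC_complex_def: "scaleC c (x :: complex) = c * x"
definition cinner_complex_def: "cinner x (y :: complex) = x * cnj y"
instance
proof
  fix x :: complex
  show "cinner x x = complex_of_real ((norm x)\<^sup>2)"
    unfolding cinner_complex_def by (rule complex_norm_square[symmetric])
qed (simp_all add: scaleC_complex_def cinner_complex_def algebra_simps scaleR_conv_of_real)
end

global_interpretation complex_vector:
  vector_space "scaleC :: complex \<Rightarrow> 'a \<Rightarrow> 'a :: complex_inner"
  by unfold_locales (rule scaleC_add_right scaleC_add_left scaleC_scaleC scaleC_one)+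

abbreviation csubspace :: "'a :: complex_inner set \<Rightarrow> bool"
  where "csubspace \<equiv> module.subspace scaleC"

abbreviation cspan :: "'a :: complex_inner set \<Rightarrow> 'a set"
  where "cspan \<equiv> module.span scaleC"

abbreviation cdim :: "'a :: complex_inner set \<Rightarrow> nat"
  where "cdim \<equiv> vector_space.dim scaleC"

definition bounded_clinear :: "('a :: complex_inner \<Rightarrow> 'a) \<Rightarrow> bool" where
  "bounded_clinear A \<longleftrightarrow> bounded_linear A \<and> (\<forall>c x. A (scaleC c x) = scaleC c (A x))"

definition cadjoint :: "('a :: complex_inner \<Rightarrow> 'a) \<Rightarrow> ('a \<Rightarrow> 'a)" where
  "cadjoint A = (SOME B. bounded_clinear B \<and> (\<forall>x y. cinner (A x) y = cinner x (B y)))"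

definition commutant :: "('a :: complex_inner \<Rightarrow> 'a) set \<Rightarrow> ('a \<Rightarrow> 'a) set" where
  "commutant X = {A. bounded_clinear A \<and> (\<forall>B\<in>X. A \<circ> B = B \<circ> A)}"


section \<open>Unitary representations\<close>

text \<open>
  Representations act on a closed subspace \<open>V\<close> of an ambient Hilbert space, so that the
  restriction of \<open>\<pi>\<close> to an invariant closed subspace is again a representation by the same
  map \<open>\<pi>\<close>; a representation on the whole space has \<open>V = UNIV\<close>. Values \<open>\<pi> g v\<close> with
  \<open>g \<notin> carrier G\<close> or \<open>v \<notin> V\<close> are irrelevant. The topology \<open>T\<close> has \<open>carrier G\<close> as its
  underlying set, and representations are strongly continuous.
\<close>

definition unitary_on :: "'h :: complex_inner set \<Rightarrow> ('h \<Rightarrow> 'h) \<Rightarrow> bool" where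
  "unitary_on V U \<longleftrightarrow>
     (\<forall>x\<in>V. \<forall>y\<in>V. U (x + y) = U x + U y) \<and>
     (\<forall>c. \<forall>x\<in>V. U (scaleC c x) = scaleC c (U x)) \<and>
     (\<forall>x\<in>V. \<forall>y\<in>V. cinner (U x) (U y) = cinner x y) \<and>
     U ` V = V"

definition unitary_rep ::
  "('g, 'b) monoid_scheme \<Rightarrow> 'g topology \<Rightarrow> 'h :: complex_hilbert set \<Rightarrow> ('g \<Rightarrow> 'h \<Rightarrow> 'h) \<Rightarrow> bool"
  where
  "unitary_rep G T V \<pi> \<longleftrightarrow>
     closed V \<and> csubspace V \<and>
     (\<forall>g\<in>carrier G. unitary_on V (\<pi> g)) \<and>
     (\<forall>g\<in>carrier G. \<forall>h\<in>carrier G. \<forall>v\<in>V. \<pi> (g \<otimes>\<^bsub>G\<^esub> h) v = \<pi> g (\<pi> h v)) \<and>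
     (\<forall>v\<in>V. continuous_map T euclidean (\<lambda>g. \<pi> g v))"

definition irreducible_rep ::
  "('g, 'b) monoid_scheme \<Rightarrow> 'h :: complex_hilbert set \<Rightarrow> ('g \<Rightarrow> 'h \<Rightarrow> 'h) \<Rightarrow> bool"
  where
  "irreducible_rep G V \<pi> \<longleftrightarrow>
     V \<noteq> {0} \<and>
     (\<forall>W. closed W \<and> csubspace W \<and> W \<subseteq> V \<and> (\<forall>g\<in>carrier G. \<pi> g ` W \<subseteq> W)
          \<longrightarrow> W = {0} \<or> W = V)"

definition invariant_vectors :: "'g set \<Rightarrow> 'h set \<Rightarrow> ('g \<Rightarrow> 'h \<Rightarrow> 'h) \<Rightarrow> 'h set" where
  "invariant_vectors K V \<pi> = {v \<in> V. \<forall>k\<in>K. \<pi> k v = v}"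

definition spherical_rep ::
  "('g, 'b) monoid_scheme \<Rightarrow> 'g topology \<Rightarrow> 'g set \<Rightarrow> 'h :: complex_hilbert set
     \<Rightarrow> ('g \<Rightarrow> 'h \<Rightarrow> 'h) \<Rightarrow> bool"
  where
  "spherical_rep G T K V \<pi> \<longleftrightarrow>
     unitary_rep G T V \<pi> \<and> irreducible_rep G V \<pi> \<and> cdim (invariant_vectors K V \<pi>) = 1"

text \<open>
  The spherical function does not depend on the choice of the unit invariant vector \<open>\<eta>\<close>,
  which is unique up to a phase; being a spherical function is stated as a relation to avoid
  choosing \<open>\<eta>\<close>.
\<close>

definition is_spherical_function ::
  "'g set \<Rightarrow> 'h :: complex_hilbert set \<Rightarrow> ('g \<Rightarrow> 'h \<Rightarrow> 'h) \<Rightarrow> ('g \<Rightarrow> complex) \<Rightarrow> bool"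
  where
  "is_spherical_function K V \<pi> \<phi> \<longleftrightarrow>
     (\<exists>\<eta>\<in>invariant_vectors K V \<pi>. norm \<eta> = 1 \<and> \<phi> = (\<lambda>g. cinner (\<pi> g \<eta>) \<eta>))"


section \<open>Characters and their GNS representations\<close>

definition positive_definite :: "('g, 'b) monoid_scheme \<Rightarrow> ('g \<Rightarrow> complex) \<Rightarrow> bool" where
  "positive_definite G chi \<longleftrightarrow>
     (\<forall>(m :: nat) (c :: nat \<Rightarrow> complex) (g :: nat \<Rightarrow> 'g). (\<forall>i<m. g i \<in> carrier G) \<longrightarrow>
        (\<Sum>i<m. \<Sum>j<m. c i * cnj (c j) * chi (inv\<^bsub>G\<^esub> (g j) \<otimes>\<^bsub>G\<^esub> g i)) \<in> \<real>\<^sub>\<ge>\<^sub>0)"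

definition character ::
  "('g, 'b) monoid_scheme \<Rightarrow> 'g topology \<Rightarrow> ('g \<Rightarrow> complex) \<Rightarrow> bool" where
  "character G T chi \<longleftrightarrow>
     continuous_map T euclidean chi \<and> positive_definite G chi \<and>
     (\<forall>g\<in>carrier G. \<forall>h\<in>carrier G. chi (g \<otimes>\<^bsub>G\<^esub> h) = chi (h \<otimes>\<^bsub>G\<^esub> g)) \<and>
     chi \<one>\<^bsub>G\<^esub> = 1"

text \<open>Functions on the group are compared on \<open>carrier G\<close> only.\<close>

definition indecomposable_character ::
  "('g, 'b) monoid_scheme \<Rightarrow> 'g topology \<Rightarrow> ('g \<Rightarrow> complex) \<Rightarrow> bool" where
  "indecomposable_character G T chi \<longleftrightarrow>
     character G T chi \<and>
     \<not> (\<exists>(\<alpha> :: real) chi1 chi2. 0 < \<alpha> \<and> \<alpha> < 1 \<and> character G T chi1 \<and> character G T chi2 \<and>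
          (\<exists>g\<in>carrier G. chi1 g \<noteq> chi2 g) \<and>
          (\<forall>g\<in>carrier G. chi g = of_real \<alpha> * chi1 g + of_real (1 - \<alpha>) * chi2 g))"

definition gns_triple ::
  "('g, 'b) monoid_scheme \<Rightarrow> 'g topology \<Rightarrow> ('g \<Rightarrow> complex)
     \<Rightarrow> ('g \<Rightarrow> 'h :: complex_hilbert \<Rightarrow> 'h) \<Rightarrow> 'h \<Rightarrow> bool" where
  "gns_triple G T chi \<pi> \<xi> \<longleftrightarrow>
     unitary_rep G T UNIV \<pi> \<and> norm \<xi> = 1 \<and>
     closure (cspan ((\<lambda>g. \<pi> g \<xi>) ` carrier G)) = UNIV \<and>
     (\<forall>g\<in>carrier G. chi g = cinner (\<pi> g \<xi>) \<xi>)"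

text \<open>The von Neumann algebra \<open>\<pi>(G)''\<close>; note that \<open>\<pi>(G)\<close> is closed under adjoints.\<close>

definition generated_vN ::
  "('g, 'b) monoid_scheme \<Rightarrow> ('g \<Rightarrow> 'h :: complex_hilbert \<Rightarrow> 'h) \<Rightarrow> ('h \<Rightarrow> 'h) set" where
  "generated_vN G \<pi> = commutant (commutant (\<pi> ` carrier G))"

definition gns_involution ::
  "('g, 'b) monoid_scheme \<Rightarrow> ('g \<Rightarrow> 'h :: complex_hilbert \<Rightarrow> 'h) \<Rightarrow> 'h \<Rightarrow> ('h \<Rightarrow> 'h)" where
  "gns_involution G \<pi> \<xi> =
     (THE S. (\<forall>x y. S (x + y) = S x + S y) \<and> (\<forall>c x. S (scaleC c x) = scaleC (cnj c) (S x)) \<and>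
             (\<forall>x. S (S x) = x) \<and> (\<forall>x. norm (S x) = norm x) \<and>
             (\<forall>b\<in>generated_vN G \<pi>. S (b \<xi>) = cadjoint b \<xi>))"

definition two_sided_rep ::
  "('g, 'b) monoid_scheme \<Rightarrow> ('g \<Rightarrow> 'h :: complex_hilbert \<Rightarrow> 'h) \<Rightarrow> 'h \<Rightarrow> 'g \<times> 'g \<Rightarrow> 'h \<Rightarrow> 'h"
  where
  "two_sided_rep G \<pi> \<xi> = (\<lambda>(g\<^sub>1, g\<^sub>2).
     let S = gns_involution G \<pi> \<xi> in \<pi> g\<^sub>1 \<circ> S \<circ> \<pi> g\<^sub>2 \<circ> S)"


section \<open>The groups \<open>G\<^sub>N\<close> and their inductive limit\<close>

type_synonym tperm = "(nat \<Rightarrow> complex) \<times> (nat \<Rightarrow> nat)"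

text \<open>
  Elements of \<open>G\<^sub>N\<close>: functions from \<open>{1..N}\<close> to the circle are extensional functions
  (\<open>undefined\<close> off \<open>{1..N}\<close>), permutations are the identity off \<open>{1..N}\<close>.
\<close>

definition G_fin :: "nat \<Rightarrow> tperm monoid" where
  "G_fin N =
     \<lparr>carrier = ({1..N} \<rightarrow>\<^sub>E sphere 0 1) \<times> {\<sigma>. \<sigma> permutes {1..N}},
      mult = (\<lambda>(t\<^sub>1, \<sigma>\<^sub>1) (t\<^sub>2, \<sigma>\<^sub>2).
                ((\<lambda>x\<in>{1..N}. t\<^sub>1 x * t\<^sub>2 (inv_into UNIV \<sigma>\<^sub>1 x)), \<sigma>\<^sub>1 \<circ> \<sigma>\<^sub>2)),
      one = ((\<lambda>x\<in>{1..N}. 1), id)\<rparr>"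

definition G_fin_top :: "nat \<Rightarrow> tperm topology" where
  "G_fin_top N =
     prod_topology (product_topology (\<lambda>_. top_of_set (sphere 0 1)) {1..N})
                   (discrete_topology {\<sigma>. \<sigma> permutes {1..N}})"

text \<open>
  Every \<open>x \<ge> 1\<close> is uniquely \<open>N * q + r\<close> with \<open>1 \<le> r \<le> N\<close>, where \<open>q = bquo N x\<close> and
  \<open>r = brem N x\<close>.
\<close>

definition bquo :: "nat \<Rightarrow> nat \<Rightarrow> nat" where "bquo N x = (x - 1) div N"
definition brem :: "nat \<Rightarrow> nat \<Rightarrow> nat" where "brem N x = (x - 1) mod N + 1"

definition block_embed :: "nat \<Rightarrow> nat \<Rightarrow> tperm \<Rightarrow> tperm" where
  "block_embed N M = (\<lambda>(t, \<sigma>).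
     ((\<lambda>x\<in>{1..M * N}. t (brem N x)),
      (\<lambda>x. if x \<in> {1..M * N} then N * bquo N x + \<sigma> (brem N x) else x)))"

text \<open>
  The inductive limit is realised as an increasing union inside the pairs of functions on the
  positive integers: \<open>limit_embed N\<close> extends an element of \<open>G\<^sub>N\<close> by the block formula with
  \<open>q\<close> unbounded. The maps \<open>limit_embed N\<close> are injective homomorphisms compatible with the
  block-diagonal embeddings (\<open>limit_embed_block_embed\<close>, \<open>inj_on_limit_embed\<close>,
  \<open>limit_embed_mult\<close> below). The irrelevant values at \<open>0\<close> are fixed.
\<close>

definition limit_embed :: "nat \<Rightarrow> tperm \<Rightarrow> tperm" where
  "limit_embed N = (\<lambda>(t, \<sigma>).
     ((\<lambda>x. if x = 0 then 1 else t (brem N x)),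
      (\<lambda>x. if x = 0 then 0 else N * bquo N x + \<sigma> (brem N x))))"

definition Nprod :: "(nat \<Rightarrow> nat) \<Rightarrow> nat \<Rightarrow> nat" where
  "Nprod n k = (\<Prod>i=1..k. n i)"

definition G_lim :: "(nat \<Rightarrow> nat) \<Rightarrow> tperm monoid" where
  "G_lim n =
     \<lparr>carrier = (\<Union>k\<in>{1..}. limit_embed (Nprod n k) ` carrier (G_fin (Nprod n k))),
      mult = (\<lambda>(t\<^sub>1, \<sigma>\<^sub>1) (t\<^sub>2, \<sigma>\<^sub>2). ((\<lambda>x. t\<^sub>1 x * t\<^sub>2 (inv_into UNIV \<sigma>\<^sub>1 x)), \<sigma>\<^sub>1 \<circ> \<sigma>\<^sub>2)),
      one = ((\<lambda>x. 1), id)\<rparr>"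

text \<open>The inductive limit topology is the final topology for the maps of the \<open>G\<^sub>N\<close> into the limit.\<close>

definition G_lim_top :: "(nat \<Rightarrow> nat) \<Rightarrow> tperm topology" where
  "G_lim_top n = topology (\<lambda>U. U \<subseteq> carrier (G_lim n) \<and>
     (\<forall>k\<ge>1. openin (G_fin_top (Nprod n k))
              {g \<in> carrier (G_fin (Nprod n k)). limit_embed (Nprod n k) g \<in> U}))"

definition F_lim :: "(nat \<Rightarrow> nat) \<Rightarrow> tperm set" where
  "F_lim n = {(t, \<sigma>) \<in> carrier (G_lim n). \<sigma> = id}"

definition S_lim :: "(nat \<Rightarrow> nat) \<Rightarrow> tperm set" where
  "S_lim n = {(t, \<sigma>) \<in> carrier (G_lim n). t = (\<lambda>x. 1)}"

definition Gamma_emb :: "tperm \<Rightarrow> tperm \<times> tperm" where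
  "Gamma_emb = (\<lambda>(t, \<sigma>). ((t, \<sigma>), ((\<lambda>x. 1), \<sigma>)))"


subsection \<open>Basic facts\<close>

lemma topspace_G_fin_top: "topspace (G_fin_top N) = carrier (G_fin N)"
  by (simp add: G_fin_top_def G_fin_def)

lemma openin_G_lim_top:
  "openin (G_lim_top n) U \<longleftrightarrow> U \<subseteq> carrier (G_lim n) \<and>
     (\<forall>k\<ge>1. openin (G_fin_top (Nprod n k))
              {g \<in> carrier (G_fin (Nprod n k)). limit_embed (Nprod n k) g \<in> U})"
proof -
  let ?P = "\<lambda>k U. {g \<in> carrier (G_fin (Nprod n k)). limit_embed (Nprod n k) g \<in> U}"
  have "istopology (\<lambda>U. U \<subseteq> carrier (G_lim n) \<and> (\<forall>k\<ge>1. openin (G_fin_top (Nprod n k)) (?P k U)))"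
    unfolding istopology_def
  proof (intro conjI allI impI)
    fix S T k
    assume "S \<subseteq> carrier (G_lim n) \<and> (\<forall>k\<ge>1. openin (G_fin_top (Nprod n k)) (?P k S))"
      "T \<subseteq> carrier (G_lim n) \<and> (\<forall>k\<ge>1. openin (G_fin_top (Nprod n k)) (?P k T))"
      "(1 :: nat) \<le> k"
    moreover have "?P k (S \<inter> T) = ?P k S \<inter> ?P k T" by auto
    ultimately show "openin (G_fin_top (Nprod n k)) (?P k (S \<inter> T))" by auto
  next
    fix \<K> k
    assume "\<forall>K\<in>\<K>. K \<subseteq> carrier (G_lim n) \<and> (\<forall>k\<ge>1. openin (G_fin_top (Nprod n k)) (?P k K))"
      "(1 :: nat) \<le> k"
    moreover have "?P k (\<Union>\<K>) = (\<Union>K\<in>\<K>. ?P k K)" by auto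
    ultimately show "openin (G_fin_top (Nprod n k)) (?P k (\<Union>\<K>))" by auto
  qed auto
  then show ?thesis
    by (simp add: G_lim_top_def)
qed

lemma topspace_G_lim_top: "topspace (G_lim_top n) = carrier (G_lim n)"
proof
  show "topspace (G_lim_top n) \<subseteq> carrier (G_lim n)"
    using openin_topspace openin_G_lim_top by blast
  have "{g \<in> carrier (G_fin (Nprod n k)). limit_embed (Nprod n k) g \<in> carrier (G_lim n)}
          = topspace (G_fin_top (Nprod n k))" if "k \<ge> 1" for k
    using that by (auto simp: G_lim_def topspace_G_fin_top)
  then have "openin (G_lim_top n) (carrier (G_lim n))"
    by (simp add: openin_G_lim_top)
  then show "carrier (G_lim n) \<subseteq> topspace (G_lim_top n)"
    by (rule openin_subset)
qed

lemma bquo_brem: "x \<ge> 1 \<Longrightarrow> x = N * bquo N x + brem N x"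
  by (simp add: bquo_def brem_def)

lemma brem_range: "N \<ge> 1 \<Longrightarrow> brem N x \<in> {1..N}"
  by (simp add: brem_def Suc_leI)

lemma bquo_brem_eq:
  assumes "r \<in> {1..N}"
  shows "bquo N (N * q + r) = q" "brem N (N * q + r) = r"
proof -
  obtain p where p: "r = Suc p" "p < N"
    using assms by (cases r) auto
  then show "bquo N (N * q + r) = q" "brem N (N * q + r) = r"
    by (simp_all add: bquo_def brem_def)
qed

lemma brem_mult: "brem N (brem (M * N) x) = brem N x"
  by (simp add: brem_def mod_mod_cancel)

lemma bquo_mult:
  assumes "N \<ge> 1"
  shows "M * N * bquo (M * N) x + N * bquo N (brem (M * N) x) = N * bquo N x"
proof -
  have "(x - 1) mod (M * N) = N * ((x - 1) div N mod M) + (x - 1) mod N"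
    by (metis mod_mult2_eq mult.commute)
  then have "(x - 1) mod (M * N) div N = (x - 1) div N mod M"
    using assms by simp
  moreover have "(x - 1) div (M * N) = (x - 1) div N div M"
    by (metis div_mult2_eq mult.commute)
  moreover have "M * N * q + N * r = N * (M * q + r)" for q r
    by (simp add: algebra_simps)
  then have "M * N * ((x - 1) div N div M) + N * ((x - 1) div N mod M) = N * ((x - 1) div N)"
    by (simp only: mult_div_mod_eq)
  ultimately show ?thesis
    by (simp add: bquo_def brem_def)
qed

lemma limit_embed_block_embed:
  assumes "N \<ge> 1" "M \<ge> 1"
  shows "limit_embed (M * N) (block_embed N M g) = limit_embed N g"
proof -
  have "brem (M * N) x \<in> {1..M * N}" for x
    using brem_range[of "M * N" x] assms by simp
  moreover have "M * N * bquo (M * N) x + (N * bquo N (brem (M * N) x) + y) = N * bquo N x + y" for x y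
    using bquo_mult[OF assms(1), of M x] by linarith
  ultimately show ?thesis
    by (cases g) (auto simp: limit_embed_def block_embed_def brem_mult fun_eq_iff)
qed

definition ext_perm :: "nat \<Rightarrow> (nat \<Rightarrow> nat) \<Rightarrow> nat \<Rightarrow> nat" where
  "ext_perm N \<sigma> x = (if x = 0 then 0 else N * bquo N x + \<sigma> (brem N x))"

definition ext_fun :: "nat \<Rightarrow> (nat \<Rightarrow> complex) \<Rightarrow> nat \<Rightarrow> complex" where
  "ext_fun N t x = (if x = 0 then 1 else t (brem N x))"

lemma limit_embed_eq: "limit_embed N (t, \<sigma>) = (ext_fun N t, ext_perm N \<sigma>)"
  by (simp add: limit_embed_def ext_fun_def ext_perm_def fun_eq_iff)

lemma ext_perm_nz:
  assumes "N \<ge> 1" "\<sigma> permutes {1..N}" "x \<ge> 1"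
  shows "ext_perm N \<sigma> x \<ge> 1" "bquo N (ext_perm N \<sigma> x) = bquo N x"
    "brem N (ext_perm N \<sigma> x) = \<sigma> (brem N x)"
proof -
  have *: "\<sigma> (brem N x) \<in> {1..N}"
    using permutes_in_image[OF assms(2), of "brem N x"] brem_range[OF assms(1)] by blast
  then show "ext_perm N \<sigma> x \<ge> 1" "bquo N (ext_perm N \<sigma> x) = bquo N x"
    "brem N (ext_perm N \<sigma> x) = \<sigma> (brem N x)"
    using bquo_brem_eq[OF *] assms(3) by (auto simp: ext_perm_def)
qed

lemma ext_perm_comp:
  assumes "N \<ge> 1" "\<sigma> permutes {1..N}" "\<tau> permutes {1..N}"
  shows "ext_perm N \<sigma> \<circ> ext_perm N \<tau> = ext_perm N (\<sigma> \<circ> \<tau>)"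
proof
  fix x
  show "(ext_perm N \<sigma> \<circ> ext_perm N \<tau>) x = ext_perm N (\<sigma> \<circ> \<tau>) x"
  proof (cases "x = 0")
    case False
    then show ?thesis
      using ext_perm_nz[OF assms(1,3), of x] by (auto simp: ext_perm_def[of N \<sigma>] ext_perm_def[of N "\<sigma> \<circ> \<tau>"])
  qed (simp add: ext_perm_def)
qed

lemma ext_perm_id: "ext_perm N id = id"
  by (auto simp: ext_perm_def fun_eq_iff simp flip: bquo_brem)

lemma ext_perm_inv:
  assumes "N \<ge> 1" "\<sigma> permutes {1..N}"
  shows "bij (ext_perm N \<sigma>)" "inv_into UNIV (ext_perm N \<sigma>) = ext_perm N (inv_into UNIV \<sigma>)"
proof -
  note p = permutes_inv[OF assms(2)]
  have 1: "ext_perm N \<sigma> \<circ> ext_perm N (inv_into UNIV \<sigma>) = id"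
    using ext_perm_comp[OF assms p] permutes_inv_o[OF assms(2)] ext_perm_id by simp
  have 2: "ext_perm N (inv_into UNIV \<sigma>) \<circ> ext_perm N \<sigma> = id"
    using ext_perm_comp[OF assms(1) p assms(2)] permutes_inv_o[OF assms(2)] ext_perm_id by simp
  show "bij (ext_perm N \<sigma>)"
    using o_bij[OF 2 1] .
  show "inv_into UNIV (ext_perm N \<sigma>) = ext_perm N (inv_into UNIV \<sigma>)"
    using inv_unique_comp[OF 1 2] .
qed

lemma group_G_fin: "group (G_fin N)"
proof (rule groupI)
  fix x y
  assume "x \<in> carrier (G_fin N)" "y \<in> carrier (G_fin N)"
  then show "x \<otimes>\<^bsub>G_fin N\<^esub> y \<in> carrier (G_fin N)"
    by (auto simp: G_fin_def PiE_iff norm_mult permutes_compose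
        intro: permutes_compose split: prod.splits)
       (metis Set.basic_monos(1) permutes_in_image permutes_inv atLeastAtMost_iff mult_1 One_nat_def)
next
  show "\<one>\<^bsub>G_fin N\<^esub> \<in> carrier (G_fin N)"
    by (auto simp: G_fin_def permutes_id)
next
  fix x y z
  assume "x \<in> carrier (G_fin N)" "y \<in> carrier (G_fin N)" "z \<in> carrier (G_fin N)"
  then obtain t\<^sub>1 \<sigma>\<^sub>1 t\<^sub>2 \<sigma>\<^sub>2 t\<^sub>3 \<sigma>\<^sub>3 where *: "x = (t\<^sub>1, \<sigma>\<^sub>1)" "y = (t\<^sub>2, \<sigma>\<^sub>2)" "z = (t\<^sub>3, \<sigma>\<^sub>3)"
    and p: "\<sigma>\<^sub>1 permutes {1..N}" "\<sigma>\<^sub>2 permutes {1..N}"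
    by (auto simp: G_fin_def)
  have "inv_into UNIV \<sigma>\<^sub>1 i \<in> {1..N}" if "i \<in> {1..N}" for i
    using permutes_in_image[OF permutes_inv[OF p(1)]] that by blast
  moreover have "inv_into UNIV (\<sigma>\<^sub>1 \<circ> \<sigma>\<^sub>2) = inv_into UNIV \<sigma>\<^sub>2 \<circ> inv_into UNIV \<sigma>\<^sub>1"
    using o_inv_distrib permutes_bij p by blast
  ultimately show "x \<otimes>\<^bsub>G_fin N\<^esub> y \<otimes>\<^bsub>G_fin N\<^esub> z = x \<otimes>\<^bsub>G_fin N\<^esub> (y \<otimes>\<^bsub>G_fin N\<^esub> z)"
    by (auto simp: * G_fin_def fun_eq_iff o_assoc mult.assoc)
next
  fix x
  assume "x \<in> carrier (G_fin N)"
  then show "\<one>\<^bsub>G_fin N\<^esub> \<otimes>\<^bsub>G_fin N\<^esub> x = x"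
    by (auto simp: G_fin_def fun_eq_iff PiE_iff extensional_def restrict_def)
next
  fix x
  assume "x \<in> carrier (G_fin N)"
  then obtain t \<sigma> where x: "x = (t, \<sigma>)" "t \<in> {1..N} \<rightarrow>\<^sub>E sphere 0 1" and p: "\<sigma> permutes {1..N}"
    by (auto simp: G_fin_def)
  note p' = permutes_inv[OF p]
  have s: "\<sigma> i \<in> {1..N}" "norm (t (\<sigma> i)) = 1" if "i \<in> {1..N}" for i
    using permutes_in_image[OF p] that x by (auto simp: PiE_iff)
  have t: "inverse (t (\<sigma> i)) * t (\<sigma> i) = 1" if "i \<in> {1..N}" for i
    using s(2)[OF that] by (metis left_inverse norm_zero zero_neq_one)
  show "\<exists>y\<in>carrier (G_fin N). y \<otimes>\<^bsub>G_fin N\<^esub> x = \<one>\<^bsub>G_fin N\<^esub>"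
  proof
    show "((\<lambda>i\<in>{1..N}. inverse (t (\<sigma> i))), inv_into UNIV \<sigma>) \<in> carrier (G_fin N)"
      using s p' by (auto simp: G_fin_def norm_inverse)
    show "((\<lambda>i\<in>{1..N}. inverse (t (\<sigma> i))), inv_into UNIV \<sigma>) \<otimes>\<^bsub>G_fin N\<^esub> x = \<one>\<^bsub>G_fin N\<^esub>"
      using t permutes_inv_o[OF p] permutes_inv_inv[OF p] by (auto simp: G_fin_def x fun_eq_iff)
  qed
qed

lemma limit_embed_mult:
  assumes "N \<ge> 1" "g \<in> carrier (G_fin N)" "h \<in> carrier (G_fin N)"
  shows "limit_embed N (g \<otimes>\<^bsub>G_fin N\<^esub> h) = limit_embed N g \<otimes>\<^bsub>G_lim n\<^esub> limit_embed N h"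
proof -
  obtain t\<^sub>1 \<sigma>\<^sub>1 t\<^sub>2 \<sigma>\<^sub>2 where *: "g = (t\<^sub>1, \<sigma>\<^sub>1)" "h = (t\<^sub>2, \<sigma>\<^sub>2)"
    and p: "\<sigma>\<^sub>1 permutes {1..N}" "\<sigma>\<^sub>2 permutes {1..N}"
    using assms by (auto simp: G_fin_def)
  note p' = permutes_inv[OF p(1)]
  have ext: "ext_fun N (\<lambda>x\<in>{1..N}. t\<^sub>1 x * t\<^sub>2 (inv_into UNIV \<sigma>\<^sub>1 x)) x
        = ext_fun N t\<^sub>1 x * ext_fun N t\<^sub>2 (ext_perm N (inv_into UNIV \<sigma>\<^sub>1) x)" for x
  proof (cases "x = 0")
    case False
    then show ?thesis
      using ext_perm_nz[OF assms(1) p', of x] brem_range[OF assms(1), of x]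
      by (auto simp: ext_fun_def)
  qed (simp add: ext_fun_def ext_perm_def)
  then show ?thesis
    using ext_perm_comp[OF assms(1) p] ext_perm_inv(2)[OF assms(1) p(1)]
    by (simp add: * G_fin_def G_lim_def limit_embed_eq fun_eq_iff ext del: One_nat_def)
qed

lemma inj_on_limit_embed:
  assumes "N \<ge> 1"
  shows "inj_on (limit_embed N) (carrier (G_fin N))"
proof (rule inj_onI)
  fix g h
  assume gh: "g \<in> carrier (G_fin N)" "h \<in> carrier (G_fin N)" "limit_embed N g = limit_embed N h"
  obtain t\<^sub>1 \<sigma>\<^sub>1 t\<^sub>2 \<sigma>\<^sub>2 where *: "g = (t\<^sub>1, \<sigma>\<^sub>1)" "h = (t\<^sub>2, \<sigma>\<^sub>2)"
    and p: "\<sigma>\<^sub>1 permutes {1..N}" "\<sigma>\<^sub>2 permutes {1..N}"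
    and t: "t\<^sub>1 \<in> extensional {1..N}" "t\<^sub>2 \<in> extensional {1..N}"
    using gh by (auto simp: G_fin_def PiE_iff)
  have e: "ext_fun N t\<^sub>1 x = ext_fun N t\<^sub>2 x" "ext_perm N \<sigma>\<^sub>1 x = ext_perm N \<sigma>\<^sub>2 x" for x
    using gh(3) by (auto simp: * limit_embed_eq)
  have "t\<^sub>1 x = t\<^sub>2 x \<and> \<sigma>\<^sub>1 x = \<sigma>\<^sub>2 x" if "x \<in> {1..N}" for x
    using e[of x] bquo_brem_eq[OF that, of 0] that by (auto simp: ext_fun_def ext_perm_def)
  moreover have "\<sigma>\<^sub>1 x = \<sigma>\<^sub>2 x" if "x \<notin> {1..N}" for x
    using that p by (simp add: permutes_def)
  moreover have "t\<^sub>1 = t\<^sub>2"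
    using t calculation(1) by (blast intro: extensionalityI)
  ultimately show "g = h"
    by (auto simp: * fun_eq_iff)
qed

lemma block_embed_carrier:
  assumes "N \<ge> 1" "M \<ge> 1" "g \<in> carrier (G_fin N)"
  shows "block_embed N M g \<in> carrier (G_fin (M * N))"
proof -
  obtain t \<sigma> where *: "g = (t, \<sigma>)" "t \<in> {1..N} \<rightarrow>\<^sub>E sphere 0 1" and p: "\<sigma> permutes {1..N}"
    using assms by (auto simp: G_fin_def)
  let ?f = "\<lambda>\<sigma> x. if x \<in> {1..M * N} then N * bquo N x + \<sigma> (brem N x) else x"
  have eq: "?f \<sigma> x = ext_perm N \<sigma> x" if "x \<in> {1..M * N}" for x and \<sigma> :: "nat \<Rightarrow> nat"
    using that by (simp add: ext_perm_def)
  have le: "ext_perm N \<sigma> x \<in> {1..M * N}" if x: "x \<in> {1..M * N}" and q: "\<sigma> permutes {1..N}" for x \<sigma>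
  proof -
    have "bquo N x < M"
      using x assms by (auto simp: bquo_def div_less_iff_less_mult)
    then have "N * bquo N x + N \<le> M * N"
      by (metis Suc_leI mult.commute mult_Suc_right add.commute mult_le_mono2)
    moreover have "\<sigma> (brem N x) \<le> N"
      using permutes_in_image[OF q, of "brem N x"] brem_range[OF assms(1), of x] by auto
    ultimately show ?thesis
      using ext_perm_nz(1)[OF assms(1) q, of x] x by (auto simp: ext_perm_def)
  qed
  have inv: "?f (inv_into UNIV \<sigma>) (?f \<sigma> x) = x" if q: "\<sigma> permutes {1..N}" for \<sigma> x
  proof (cases "x \<in> {1..M * N}")
    case True
    have "ext_perm N (inv_into UNIV \<sigma>) (ext_perm N \<sigma> x) = x"
      using ext_perm_comp[OF assms(1) permutes_inv[OF q] q] permutes_inv_o(2)[OF q] ext_perm_id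
      by (metis comp_apply id_apply)
    then show ?thesis
      using eq[OF True] eq[OF le[OF True q]] by metis
  qed auto
  have "bij (?f \<sigma>)"
  proof (rule o_bij)
    show "?f (inv_into UNIV \<sigma>) \<circ> ?f \<sigma> = id"
      using inv[OF p] by (simp only: fun_eq_iff comp_apply id_apply simp_thms)
    show "?f \<sigma> \<circ> ?f (inv_into UNIV \<sigma>) = id"
      using inv[OF permutes_inv[OF p]] unfolding permutes_inv_inv[OF p]
      by (simp only: fun_eq_iff comp_apply id_apply simp_thms)
  qed
  then have "?f \<sigma> permutes {1..M * N}"
    unfolding permutes_def bij_iff by (intro conjI allI impI if_not_P) blast+
  moreover have "norm (t (brem N x)) = 1" for x
    using * brem_range[OF assms(1), of x] by (auto simp: PiE_iff)
  ultimately show ?thesis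
    by (simp add: * G_fin_def block_embed_def)
qed

lemma Nprod_ge_1: "\<forall>i\<ge>1. n i > 1 \<Longrightarrow> Nprod n k \<ge> 1"
  unfolding Nprod_def by (rule prod_ge_1) force

lemma Nprod_split: "k \<le> l \<Longrightarrow> Nprod n l = (\<Prod>i=Suc k..l. n i) * Nprod n k"
  unfolding Nprod_def
  by (metis Suc_le_mono atLeastLessThanSuc_atLeastAtMost le_add1 mult.commute plus_1_eq_Suc
      prod.atLeastLessThan_concat)

lemma limit_embed_mono:
  assumes n: "\<forall>i\<ge>1. n i > 1" and "k \<le> l"
  shows "limit_embed (Nprod n k) ` carrier (G_fin (Nprod n k))
           \<subseteq> limit_embed (Nprod n l) ` carrier (G_fin (Nprod n l))"
proof -
  let ?M = "\<Prod>i=Suc k..l. n i"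
  have M: "?M \<ge> 1" by (rule prod_ge_1) (use n in \<open>simp add: less_imp_le\<close>)
  note N = Nprod_ge_1[OF n, of k]
  show ?thesis
    unfolding Nprod_split[OF assms(2), of n]
  proof (rule image_subsetI, rule image_eqI)
    fix g
    assume g: "g \<in> carrier (G_fin (Nprod n k))"
    show "limit_embed (Nprod n k) g
            = limit_embed (?M * Nprod n k) (block_embed (Nprod n k) ?M g)"
      by (rule limit_embed_block_embed[OF N M, symmetric])
    show "block_embed (Nprod n k) ?M g \<in> carrier (G_fin (?M * Nprod n k))"
      by (rule block_embed_carrier[OF N M g])
  qed
qed

lemma limit_embed_one: "limit_embed N \<one>\<^bsub>G_fin N\<^esub> = \<one>\<^bsub>G_lim n\<^esub>" if "N \<ge> 1"
  using brem_range[OF that] ext_perm_id[of N]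
  by (auto simp: G_fin_def G_lim_def limit_embed_eq ext_fun_def fun_eq_iff)

lemma G_lim_carrier_level:
  assumes n: "\<forall>i\<ge>1. n i > 1"
    and "g \<in> carrier (G_lim n)" "h \<in> carrier (G_lim n)" "f \<in> carrier (G_lim n)"
  obtains k g' h' f' where "k \<ge> 1"
    "g' \<in> carrier (G_fin (Nprod n k))" "g = limit_embed (Nprod n k) g'"
    "h' \<in> carrier (G_fin (Nprod n k))" "h = limit_embed (Nprod n k) h'"
    "f' \<in> carrier (G_fin (Nprod n k))" "f = limit_embed (Nprod n k) f'"
proof -
  let ?I = "\<lambda>k. limit_embed (Nprod n k) ` carrier (G_fin (Nprod n k))"
  obtain a b c where "a \<ge> 1" "g \<in> ?I a" "b \<ge> 1" "h \<in> ?I b" "c \<ge> 1" "f \<in> ?I c"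
    using assms(2-4) by (auto simp: G_lim_def)
  moreover have "?I a \<subseteq> ?I (max a (max b c))" "?I b \<subseteq> ?I (max a (max b c))"
    "?I c \<subseteq> ?I (max a (max b c))"
    using limit_embed_mono[OF n] by simp_all
  ultimately have "max a (max b c) \<ge> 1" "g \<in> ?I (max a (max b c))" "h \<in> ?I (max a (max b c))"
    "f \<in> ?I (max a (max b c))"
    by auto
  then show ?thesis
    by (elim imageE) (rule that)
qed

lemma limit_embed_carrier:
  "k \<ge> 1 \<Longrightarrow> g \<in> carrier (G_fin (Nprod n k)) \<Longrightarrow> limit_embed (Nprod n k) g \<in> carrier (G_lim n)"
  by (auto simp: G_lim_def)

lemma group_G_lim:
  assumes n: "\<forall>i\<ge>1. n i > 1"
  shows "group (G_lim n)"
proof (rule groupI)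
  note N = Nprod_ge_1[OF n]
  note mult = limit_embed_mult[OF N, symmetric]
  fix x y
  assume "x \<in> carrier (G_lim n)" "y \<in> carrier (G_lim n)"
  then obtain k x' y' where "k \<ge> 1"
    "x' \<in> carrier (G_fin (Nprod n k))" "x = limit_embed (Nprod n k) x'"
    "y' \<in> carrier (G_fin (Nprod n k))" "y = limit_embed (Nprod n k) y'"
    using G_lim_carrier_level[OF n, of x y y] by metis
  then show "x \<otimes>\<^bsub>G_lim n\<^esub> y \<in> carrier (G_lim n)"
    using group.is_monoid[OF group_G_fin] limit_embed_carrier by (simp add: mult monoid.m_closed)
next
  show "\<one>\<^bsub>G_lim n\<^esub> \<in> carrier (G_lim n)"
    using limit_embed_carrier[OF order_refl monoid.one_closed[OF group.is_monoid[OF group_G_fin]], of n]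
    unfolding limit_embed_one[OF Nprod_ge_1[OF n], of _ n] .
next
  note N = Nprod_ge_1[OF n]
  note mult = limit_embed_mult[OF N, symmetric]
  fix x y z
  assume "x \<in> carrier (G_lim n)" "y \<in> carrier (G_lim n)" "z \<in> carrier (G_lim n)"
  then obtain k x' y' z' where "k \<ge> 1"
    "x' \<in> carrier (G_fin (Nprod n k))" "x = limit_embed (Nprod n k) x'"
    "y' \<in> carrier (G_fin (Nprod n k))" "y = limit_embed (Nprod n k) y'"
    "z' \<in> carrier (G_fin (Nprod n k))" "z = limit_embed (Nprod n k) z'"
    using G_lim_carrier_level[OF n, of x y z] by metis
  then show "x \<otimes>\<^bsub>G_lim n\<^esub> y \<otimes>\<^bsub>G_lim n\<^esub> z = x \<otimes>\<^bsub>G_lim n\<^esub> (y \<otimes>\<^bsub>G_lim n\<^esub> z)"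
    using group.is_monoid[OF group_G_fin]
    by (simp add: mult monoid.m_closed monoid.m_assoc)
next
  fix x
  show "\<one>\<^bsub>G_lim n\<^esub> \<otimes>\<^bsub>G_lim n\<^esub> x = x"
    by (auto simp: G_lim_def split: prod.splits)
next
  note N = Nprod_ge_1[OF n]
  fix x
  assume "x \<in> carrier (G_lim n)"
  then obtain k x' where k: "k \<ge> 1"
    "x' \<in> carrier (G_fin (Nprod n k))" "x = limit_embed (Nprod n k) x'"
    by (auto simp: G_lim_def)
  let ?y = "inv\<^bsub>G_fin (Nprod n k)\<^esub> x'"
  have y: "?y \<in> carrier (G_fin (Nprod n k))"
    using k group_G_fin by (simp add: group.inv_closed)
  have "limit_embed (Nprod n k) ?y \<otimes>\<^bsub>G_lim n\<^esub> x = \<one>\<^bsub>G_lim n\<^esub>"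
    unfolding k(3) limit_embed_mult[OF N y k(2), of n, symmetric] group.l_inv[OF group_G_fin k(2)]
    by (rule limit_embed_one[OF N])
  then show "\<exists>y\<in>carrier (G_lim n). y \<otimes>\<^bsub>G_lim n\<^esub> x = \<one>\<^bsub>G_lim n\<^esub>"
    using limit_embed_carrier[OF k(1) y] by blast
qed

lemma G_lim_S_lim:
  assumes n: "\<forall>i\<ge>1. n i > 1" and g: "(t, \<sigma>) \<in> carrier (G_lim n)"
  shows "((\<lambda>x. 1), \<sigma>) \<in> S_lim n"
proof -
  obtain k t' \<sigma>' where k: "k \<ge> 1" "(t', \<sigma>') \<in> carrier (G_fin (Nprod n k))"
    "(t, \<sigma>) = limit_embed (Nprod n k) (t', \<sigma>')"
    using g by (force simp: G_lim_def)
  have "((\<lambda>x\<in>{1..Nprod n k}. 1), \<sigma>') \<in> carrier (G_fin (Nprod n k))"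
    using k by (auto simp: G_fin_def)
  moreover have "limit_embed (Nprod n k) ((\<lambda>x\<in>{1..Nprod n k}. 1), \<sigma>') = ((\<lambda>x. 1), \<sigma>)"
    using k(3) brem_range[OF Nprod_ge_1[OF n]]
    by (auto simp: limit_embed_eq ext_fun_def fun_eq_iff simp del: One_nat_def)
  ultimately show ?thesis
    using limit_embed_carrier[OF k(1), of "((\<lambda>x\<in>{1..Nprod n k}. 1), \<sigma>')" n]
    by (simp add: S_lim_def)
qed

lemma Gamma_emb_hom:
  assumes "\<forall>i\<ge>1. n i > 1"
  shows "Gamma_emb \<in> hom (G_lim n) (G_lim n \<times>\<times> G_lim n)" "inj Gamma_emb"
proof -
  show "inj Gamma_emb"
    by (auto simp: inj_on_def Gamma_emb_def)
  have "Gamma_emb g \<in> carrier (G_lim n \<times>\<times> G_lim n)" if "g \<in> carrier (G_lim n)" for g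
    using that G_lim_S_lim[OF assms] by (cases g) (auto simp: Gamma_emb_def S_lim_def)
  then show "Gamma_emb \<in> hom (G_lim n) (G_lim n \<times>\<times> G_lim n)"
    by (intro homI) (auto simp: Gamma_emb_def DirProd_def G_lim_def split: prod.splits)
qed

end

theory Submission
  imports Defs
begin

text \<open>
  Let \<open>R g = S \<circ> \<pi> g \<circ> S\<close> be the right action of the group on the GNS space, which commutes with
  \<open>\<pi>\<close>, and call a vector central if it is fixed by all \<open>\<pi> g \<circ> R g\<close>. In the composition of the
  two-sided representation with \<open>Gamma_emb\<close>, a permutation \<open>s\<close> acts by the conjugation
  \<open>\<pi> s \<circ> R s\<close>, whereas a function \<open>t\<close> acts by \<open>\<pi> t\<close>.
  Functions commute, so conjugation by a function is trivial on the closed span \<open>V\<close> of the vectors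
  \<open>\<pi> t \<xi>\<close>. Functions and permutations generate the group, so a vector of \<open>V\<close> that is invariant
  under the permutations is central.

  The heart of the matter is that for an indecomposable character every central vector is a
  multiple of \<open>\<xi>\<close> (\<open>central_vector_scalar\<close>). This says that the generated von Neumann algebra is
  a factor, in a form that also covers the unbounded operators affiliated with its centre. A
  central vector \<open>v\<close> defines a densely defined operator with \<open>\<pi> g \<xi> \<mapsto> \<pi> g v\<close>. Projecting
  \<open>(\<xi>, 0)\<close> onto the closure of its graph splits the character into two finite traces.
  Indecomposability (\<open>indecomposable_character_summand\<close>) makes them multiples of the character,
  which forces the state of \<open>v\<close> to be a multiple of the character (\<open>central_vector_state\<close>), and polarisation
  with \<open>\<xi>\<close> finishes the argument.

  Hence the invariant vectors in \<open>V\<close> are the multiples of \<open>\<xi>\<close>. Irreducibility follows: the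
  projection of \<open>\<xi>\<close> onto an invariant subspace is an invariant vector, so it is \<open>0\<close> or \<open>\<xi>\<close>.
  The spherical function is the state of \<open>\<xi>\<close>, which on functions is the character.

  All of this holds for any semidirect product with an abelian normal subgroup and a continuous
  projection onto the complement (locale \<open>split_gns\<close>). What remains specific is that taking the
  permutation part is such a projection for the inductive limit.

  The involution \<open>S\<close> is given by a definite description over the whole von Neumann algebra;
  \<open>gns_involution_conjugation\<close> shows that it is the antiunitary extension of
  \<open>\<pi> g \<xi> \<mapsto> \<pi> (inv g) \<xi>\<close>.
\<close>

section \<open>Inner products\<close>

lemma cinner_add_right: "cinner x (y + z) = cinner x y + cinner x z"
  by (metis cinner_add_left cinner_commute complex_cnj_add)

lemma cinner_scaleC_right: "cinner x (scaleC c y) = cnj c * cinner x y"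
  by (metis cinner_commute cinner_scaleC_left complex_cnj_mult)

lemma cinner_zero [simp]: "cinner 0 y = 0" "cinner x 0 = 0"
  using cinner_add_left[of 0 0 y] cinner_add_right[of x 0 0] by simp_all

lemma cinner_minus: "cinner (- x) y = - cinner x y" "cinner x (- y) = - cinner x y"
proof -
  have "cinner (- x) y + cinner x y = 0" "cinner x (- y) + cinner x y = 0"
    by (simp_all flip: cinner_add_left cinner_add_right)
  then show "cinner (- x) y = - cinner x y" "cinner x (- y) = - cinner x y"
    by (simp_all add: add_eq_0_iff2)
qed

lemma cinner_diff_left: "cinner (x - y) z = cinner x z - cinner y z"
  using cinner_add_left[of x "- y" z] by (simp add: cinner_minus)

lemma cinner_diff_right: "cinner z (x - y) = cinner z x - cinner z y"
  using cinner_add_right[of z x "- y"] by (simp add: cinner_minus)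

lemmas cinner_algebra = cinner_add_left cinner_add_right cinner_diff_left cinner_diff_right
  cinner_scaleC_left cinner_scaleC_right

lemma cinner_sum_left: "cinner (sum f A) y = (\<Sum>i\<in>A. cinner (f i) y)"
  by (induction A rule: infinite_finite_induct) (simp_all add: cinner_add_left)

lemma cinner_sum_right: "cinner x (sum f A) = (\<Sum>i\<in>A. cinner x (f i))"
  by (induction A rule: infinite_finite_induct) (simp_all add: cinner_add_right)

lemma cinner_self_eq_0: "cinner x x = 0 \<Longrightarrow> x = 0"
  by (simp add: cinner_self)

lemma norm_sq_eq_Re_cinner: "(norm x)\<^sup>2 = Re (cinner x x)"
  by (simp add: cinner_self)

lemma norm_scaleC: "norm (scaleC c x) = norm c * norm x"
proof -
  have "complex_of_real ((norm (scaleC c x))\<^sup>2) = complex_of_real ((norm c * norm x)\<^sup>2)"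
    unfolding cinner_self[symmetric] cinner_scaleC_left cinner_scaleC_right
    by (simp add: cinner_self complex_norm_square power_mult_distrib mult.commute flip: complex_norm_square)
  then have "(norm (scaleC c x))\<^sup>2 = (norm c * norm x)\<^sup>2"
    by (simp only: of_real_eq_iff)
  then show ?thesis
    by (rule power2_eq_imp_eq) simp_all
qed

lemma scaleC_diff_right: "scaleC c (x - y) = scaleC c x - scaleC c y"
  by (metis add_diff_cancel_right' diff_add_cancel scaleC_add_right)

lemma scaleC_zero [simp]: "scaleC c 0 = 0" "scaleC 0 x = 0"
  using norm_scaleC[of c "0 :: 'a"] norm_scaleC[of 0 x] by simp_all

text \<open>
  The class provides a norm, so the triangle inequality is already known; squaring it bounds
  the real part of the inner product. Rotating \<open>x\<close> by a phase makes the inner product equal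
  to its modulus.
\<close>

lemma Cauchy_Schwarz_cinner: "norm (cinner x y) \<le> norm x * norm y"
proof -
  have Re: "Re (cinner x y) \<le> norm x * norm y" for x
  proof -
    have "(norm (x + y))\<^sup>2 = (norm x)\<^sup>2 + 2 * Re (cinner x y) + (norm y)\<^sup>2"
      using cinner_commute[of y x] by (simp add: norm_sq_eq_Re_cinner cinner_algebra)
    moreover have "(norm (x + y))\<^sup>2 \<le> (norm x + norm y)\<^sup>2"
      by (intro power_mono norm_triangle_ineq) simp
    ultimately show ?thesis
      by (simp add: power2_sum)
  qed
  show ?thesis
  proof (cases "cinner x y = 0")
    case False
    let ?c = "cnj (sgn (cinner x y))"
    have "?c * cinner x y = norm (cinner x y)"
      using False by (simp add: sgn_div_norm scaleR_conv_of_real mult.commute field_simps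
          flip: complex_norm_square power2_eq_square)
    then have "norm (cinner x y) = Re (cinner (scaleC ?c x) y)"
      by (simp add: cinner_scaleC_left)
    also have "\<dots> \<le> norm (scaleC ?c x) * norm y"
      by (rule Re)
    also have "\<dots> = norm x * norm y"
      using False by (simp add: norm_scaleC norm_sgn)
    finally show ?thesis .
  qed simp
qed

lemma bounded_bilinear_cinner: "bounded_bilinear cinner"
proof
  fix r :: real and x y :: 'a
  show "cinner (r *\<^sub>R x) y = r *\<^sub>R cinner x y" "cinner x (r *\<^sub>R y) = r *\<^sub>R cinner x y"
    by (simp_all add: scaleR_scaleC cinner_scaleC_left cinner_scaleC_right scaleC_complex_def)
  show "\<exists>K. \<forall>a b. norm (cinner a (b :: 'a)) \<le> norm a * norm b * K"
    by (intro exI[of _ 1]) (simp add: Cauchy_Schwarz_cinner)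
qed (rule cinner_add_left cinner_add_right)+

lemmas continuous_on_cinner [continuous_intros] =
  bounded_bilinear.continuous_on[OF bounded_bilinear_cinner]

lemma bounded_linear_scaleC: "bounded_linear (scaleC c)"
  by (rule bounded_linear_intro[where K = "norm c"])
    (simp_all add: scaleC_add_right norm_scaleC scaleR_scaleC scaleC_scaleC mult.commute)

section \<open>Closed subspaces, projections and adjoints\<close>

lemma csubspaceI:
  "0 \<in> W \<Longrightarrow> (\<And>x y. x \<in> W \<Longrightarrow> y \<in> W \<Longrightarrow> x + y \<in> W) \<Longrightarrow> (\<And>c x. x \<in> W \<Longrightarrow> scaleC c x \<in> W)
    \<Longrightarrow> csubspace W"
  by (auto simp: complex_vector.subspace_def)

lemma csubspace_closure:
  fixes W :: "'a :: complex_inner set"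
  assumes "csubspace W"
  shows "csubspace (closure W)"
proof (rule csubspaceI)
  show "0 \<in> closure W"
    using complex_vector.subspace_0[OF assms] closure_subset by auto
next
  fix x y :: 'a
  assume "x \<in> closure W" "y \<in> closure W"
  then obtain X Y where "\<forall>n. X n \<in> W" "X \<longlonglongrightarrow> x" "\<forall>n. Y n \<in> W" "Y \<longlonglongrightarrow> y"
    unfolding closure_sequential by blast
  then show "x + y \<in> closure W"
    unfolding closure_sequential using complex_vector.subspace_add[OF assms]
    by (intro exI[of _ "\<lambda>n. X n + Y n"]) (auto intro: tendsto_add)
next
  fix c :: complex and x :: 'a
  assume "x \<in> closure W"
  then obtain X where "\<forall>n. X n \<in> W" "X \<longlonglongrightarrow> x"
    unfolding closure_sequential by blast
  then show "scaleC c x \<in> closure W"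
    unfolding closure_sequential using complex_vector.subspace_scale[OF assms]
    by (intro exI[of _ "\<lambda>n. scaleC c (X n)"])
      (auto intro: bounded_linear.tendsto[OF bounded_linear_scaleC])
qed

lemma closure_cspan_minimal:
  assumes "closed W" "csubspace W" "X \<subseteq> W"
  shows "closure (cspan X) \<subseteq> W"
  using assms by (intro closure_minimal complex_vector.span_minimal)

lemma closure_cspan_superset: "X \<subseteq> closure (cspan X)"
  using complex_vector.span_superset closure_subset by blast

lemma csubspace_closure_cspan: "csubspace (closure (cspan X))"
  by (intro csubspace_closure complex_vector.subspace_span)

text \<open>
  The residual \<open>x - p\<close> of an orthogonal projection determines \<open>p\<close>: two candidates differ by
  an element of \<open>W\<close> that is orthogonal to \<open>W\<close>.
\<close>

lemma projection_unique:
  assumes "csubspace W" "p \<in> W" "p' \<in> W"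
    and "\<And>w. w \<in> W \<Longrightarrow> cinner (x - p) w = 0" "\<And>w. w \<in> W \<Longrightarrow> cinner (x - p') w = 0"
  shows "p = p'"
proof -
  have "p - p' \<in> W"
    using assms(1-3) by (rule complex_vector.subspace_diff)
  then have "cinner (x - p') (p - p') - cinner (x - p) (p - p') = 0"
    using assms(4,5) by simp
  then have "cinner (p - p') (p - p') = 0"
    by (simp flip: cinner_diff_left)
  then show ?thesis
    using cinner_self_eq_0 by force
qed

lemma parallelogram_law:
  fixes x y :: "'a :: complex_inner"
  shows "(norm (x + y))\<^sup>2 + (norm (x - y))\<^sup>2 = 2 * (norm x)\<^sup>2 + 2 * (norm y)\<^sup>2"
  by (simp add: norm_sq_eq_Re_cinner cinner_algebra)

text \<open>
  If \<open>x - p\<close> had a component along \<open>w\<close>, moving \<open>p\<close> by that component would bring it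
  closer to \<open>x\<close>.
\<close>

lemma orthogonal_of_nearest:
  assumes W: "csubspace W" "p \<in> W" and near: "\<And>w. w \<in> W \<Longrightarrow> norm (x - p) \<le> norm (x - w)"
    and w: "w \<in> W"
  shows "cinner (x - p) w = 0"
proof (cases "w = 0")
  case False
  let ?z = "cinner (x - p) w"
  define c where "c = ?z / of_real ((norm w)\<^sup>2)"
  have "(norm (x - p))\<^sup>2 \<le> (norm (x - (p + scaleC c w)))\<^sup>2"
    using W w by (intro power_mono near complex_vector.subspace_add complex_vector.subspace_scale) auto
  also have "x - (p + scaleC c w) = (x - p) - scaleC c w" by simp
  also have "(norm ((x - p) - scaleC c w))\<^sup>2
      = (norm (x - p))\<^sup>2 - Re (cnj c * ?z) - Re (c * cnj ?z) + Re (c * cnj c * cinner w w)"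
    using cinner_commute[of w "x - p"]
    unfolding norm_sq_eq_Re_cinner cinner_diff_left[of "x - p"] cinner_diff_right[of _ "x - p"]
    by (simp add: cinner_scaleC_left cinner_scaleC_right algebra_simps del: cinner_diff_left)
  also have "c * cnj c * cinner w w = c * cnj ?z"
    using False by (simp add: c_def cinner_self power2_eq_square)
  finally have "Re (cnj c * ?z) \<le> 0"
    by simp
  moreover have "cnj c * ?z = of_real ((norm ?z)\<^sup>2 / (norm w)\<^sup>2)"
    by (simp add: c_def mult.commute flip: complex_norm_square)
  ultimately have "(norm ?z)\<^sup>2 / (norm w)\<^sup>2 \<le> 0"
    by (metis Re_complex_of_real)
  then show ?thesis
    using False by (simp add: divide_le_0_iff zero_less_power2)
qed simp

text \<open>
  By the parallelogram law a sequence in \<open>W\<close> whose distances to \<open>x\<close> tend to the infimum is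
  Cauchy, because the midpoints are in \<open>W\<close> and hence at least as far away as the infimum.
\<close>

lemma projection_exists:
  fixes W :: "'a :: complex_hilbert set"
  assumes W: "closed W" "csubspace W"
  shows "\<exists>p\<in>W. \<forall>w\<in>W. cinner (x - p) w = 0"
proof -
  define d where "d = infdist x W"
  have ne: "W \<noteq> {}"
    using complex_vector.subspace_0[OF W(2)] by auto
  have d_le: "d \<le> norm (x - w)" if "w \<in> W" for w
    using infdist_le[OF that, of x] by (simp add: d_def dist_norm)
  have d0: "d \<ge> 0"
    by (simp add: d_def infdist_nonneg)
  have "\<exists>w\<in>W. (norm (x - w))\<^sup>2 < d\<^sup>2 + 1 / Suc m" for m :: nat
  proof -
    have "d < sqrt (d\<^sup>2 + 1 / Suc m)"
      by (rule real_less_rsqrt) simp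
    then have "\<exists>w\<in>W. dist x w < sqrt (d\<^sup>2 + 1 / Suc m)"
      using ne by (simp add: d_def infdist_def cINF_less_iff)
    then obtain w where w: "w \<in> W" "norm (x - w) < sqrt (d\<^sup>2 + 1 / Suc m)"
      by (auto simp: dist_norm)
    then have "(norm (x - w))\<^sup>2 < (sqrt (d\<^sup>2 + 1 / Suc m))\<^sup>2"
      by (intro power_strict_mono) auto
    then show ?thesis
      using w(1) by (intro bexI[of _ w]) auto
  qed
  then obtain w where wW: "\<And>m. w m \<in> W" and w: "\<And>m. (norm (x - w m))\<^sup>2 < d\<^sup>2 + 1 / Suc m"
    by metis
  have close: "(norm (w m - w l))\<^sup>2 \<le> 2 / Suc m + 2 / Suc l" for m l
  proof -
    \<comment> \<open>The midpoint of two almost nearest points bounds their difference from above.\<close>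
    have "scaleC (1/2) (w m + w l) \<in> W"
      using W wW by (intro complex_vector.subspace_scale complex_vector.subspace_add)
    then have "d\<^sup>2 \<le> (norm (x - scaleC (1/2) (w m + w l)))\<^sup>2"
      using d0 by (intro power_mono d_le)
    moreover have "(x - w m) + (x - w l) = scaleC 2 (x - scaleC (1/2) (w m + w l))"
      using scaleC_add_left[of 1 1 x]
      by (simp add: scaleC_diff_right scaleC_scaleC scaleC_one)
    then have "(norm ((x - w m) + (x - w l)))\<^sup>2 = 4 * (norm (x - scaleC (1/2) (w m + w l)))\<^sup>2"
      by (simp add: norm_scaleC power_mult_distrib)
    moreover have "norm ((x - w m) - (x - w l)) = norm (w m - w l)"
      by (simp add: norm_minus_commute)
    ultimately show ?thesis
      using parallelogram_law[of "x - w m" "x - w l"] w[of m] w[of l] by simp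
  qed
  have "Cauchy w"
  proof (rule metric_CauchyI)
    fix e :: real assume e: "e > 0"
    then obtain M :: nat where M: "4 / e\<^sup>2 < Suc M"
      by (metis less_Suc_eq of_nat_less_iff reals_Archimedean2 order.strict_trans)
    show "\<exists>M. \<forall>m\<ge>M. \<forall>l\<ge>M. dist (w m) (w l) < e"
    proof (intro exI[of _ M] allI impI)
      fix m l assume "M \<le> m" "M \<le> l"
      then have "2 / real (Suc m) \<le> 2 / Suc M" "2 / real (Suc l) \<le> 2 / Suc M"
        by (auto intro!: divide_left_mono)
      then have "(norm (w m - w l))\<^sup>2 \<le> 4 / Suc M"
        using close[of m l] by simp
      also have "\<dots> < e\<^sup>2"
        using M e by (simp add: field_simps)
      finally show "dist (w m) (w l) < e"
        using e by (simp add: dist_norm power2_less_imp_less)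
    qed
  qed
  then obtain p where p: "w \<longlonglongrightarrow> p"
    using Cauchy_convergent convergent_def by blast
  have pW: "p \<in> W"
    using closed_sequentially[OF W(1)] wW p by blast
  have "(\<lambda>m. (norm (x - w m))\<^sup>2) \<longlonglongrightarrow> (norm (x - p))\<^sup>2"
    by (intro tendsto_intros p)
  moreover have "(\<lambda>m. d\<^sup>2 + 1 / Suc m) \<longlonglongrightarrow> d\<^sup>2 + 0"
    using LIMSEQ_Suc[OF lim_1_over_n] by (intro tendsto_intros)
  ultimately have "(norm (x - p))\<^sup>2 \<le> d\<^sup>2"
    using w by (intro LIMSEQ_le[of _ _ "\<lambda>m. d\<^sup>2 + 1 / Suc m"]) (auto intro!: exI[of _ 0] less_imp_le)
  then have "norm (x - p) \<le> d"
    using d0 by (rule power2_le_imp_le)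
  then have "cinner (x - p) v = 0" if "v \<in> W" for v
    using orthogonal_of_nearest[OF W(2) pW _ that] d_le by (meson order_trans)
  then show ?thesis
    using pW by blast
qed

text \<open>
  The projection onto a subspace that is stable under an operator and its adjoint commutes with
  the operator, so it preserves fixed vectors. This is the source of the central and invariant
  vectors below.
\<close>

lemma fixed_projection:
  assumes "csubspace W" "p \<in> W" and orth: "\<And>w. w \<in> W \<Longrightarrow> cinner (x - p) w = 0"
    and adj: "\<And>y z. cinner (U y) z = cinner y (U' z)"
    and "\<And>w. w \<in> W \<Longrightarrow> U w \<in> W" "\<And>w. w \<in> W \<Longrightarrow> U' w \<in> W"
    and "U x = x"
  shows "U p = p"
proof (rule projection_unique[OF assms(1)])
  fix w assume w: "w \<in> W"
  have "cinner (x - U p) w = cinner (U x - U p) w"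
    using assms by simp
  also have "\<dots> = cinner (x - p) (U' w)"
    by (simp add: cinner_diff_left adj)
  also have "\<dots> = 0"
    using assms w by blast
  finally show "cinner (x - U p) w = 0" .
qed (use assms in auto)

text \<open>
  The kernel of a nonzero continuous functional is a closed hyperplane; a vector orthogonal to
  it represents the functional up to a scalar.
\<close>

lemma Riesz_representation:
  fixes f :: "'a :: complex_hilbert \<Rightarrow> complex"
  assumes add: "\<And>x y. f (x + y) = f x + f y" and scale: "\<And>c x. f (scaleC c x) = c * f x"
    and cont: "continuous_on UNIV f"
  obtains y where "\<And>x. f x = cinner x y"
proof (cases "\<forall>x. f x = 0")
  case True
  then show ?thesis using that[of 0] by simp
next
  case False
  then obtain z where z: "f z \<noteq> 0" by blast
  let ?K = "{x. f x = 0}"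
  have f0: "f 0 = 0" using add[of 0 0] by simp
  have fd: "f (x - y) = f x - f y" for x y
    using add[of "x - y" y] by simp
  have "closed ?K"
    using closed_Collect_eq[OF cont continuous_on_const] .
  moreover have "csubspace ?K"
    by (rule csubspaceI) (simp_all add: add scale f0)
  ultimately have "\<exists>p\<in>?K. \<forall>w\<in>?K. cinner (z - p) w = 0"
    by (rule projection_exists)
  then obtain p where p: "f p = 0" "\<And>w. f w = 0 \<Longrightarrow> cinner (z - p) w = 0"
    by auto
  define u where "u = z - p"
  have fu: "f u \<noteq> 0" using z p(1) by (simp add: u_def fd)
  then have uu: "cinner u u \<noteq> 0"
    using cinner_self_eq_0 f0 by blast
  show ?thesis
  proof (rule that)
    fix x
    have "f (scaleC (f u) x - scaleC (f x) u) = 0"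
      by (simp add: fd scale mult.commute)
    then have "cinner u (scaleC (f u) x - scaleC (f x) u) = 0"
      using p(2) by (simp add: u_def)
    then have "cinner (scaleC (f u) x - scaleC (f x) u) u = 0"
      by (metis cinner_commute complex_cnj_zero)
    then have "f u * cinner x u = f x * cinner u u"
      by (simp add: cinner_diff_left cinner_scaleC_left)
    then show "f x = cinner x (scaleC (cnj (f u / cinner u u)) u)"
      using uu by (simp add: cinner_scaleC_right field_simps)
  qed
qed

lemma bounded_clinearD:
  assumes "bounded_clinear A"
  shows "A (x + y) = A x + A y" "A (scaleC c x) = scaleC c (A x)" "continuous_on X A"
  using assms by (auto simp: bounded_clinear_def linear_add bounded_linear.linear
      linear_continuous_on)

lemma bounded_clinear_compose:
  "bounded_clinear A \<Longrightarrow> bounded_clinear B \<Longrightarrow> bounded_clinear (\<lambda>x. A (B x))"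
  unfolding bounded_clinear_def by (auto intro: bounded_linear_compose)

lemma bounded_clinear_closure_cspan:
  assumes A: "bounded_clinear A" and W: "closed W" "csubspace W" and X: "\<And>x. x \<in> X \<Longrightarrow> A x \<in> W"
    and x: "x \<in> closure (cspan X)"
  shows "A x \<in> W"
proof -
  have "closure (cspan X) \<subseteq> A -` W"
  proof (rule closure_cspan_minimal)
    show "closed (A -` W)"
      using W bounded_clinearD(3)[OF A] by (intro closed_vimage)
    show "csubspace (A -` W)"
      using W bounded_clinearD(2)[OF A, of 0 0]
      by (intro csubspaceI) (auto simp: bounded_clinearD(1,2)[OF A] complex_vector.subspace_0
          complex_vector.subspace_add complex_vector.subspace_scale)
  qed (use X in auto)
  then show ?thesis using x by blast
qed

text \<open>
  Without this, the choice operator in the definition of \<open>cadjoint\<close> would return an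
  unspecified function.
\<close>

lemma cadjoint_exists:
  fixes A :: "'a :: complex_hilbert \<Rightarrow> 'a"
  assumes A: "bounded_clinear A"
  obtains B where "bounded_clinear B" "\<And>x y. cinner (A x) y = cinner x (B y)"
proof -
  have "\<exists>z. \<forall>x. cinner (A x) y = cinner x z" for y
    by (rule Riesz_representation[of "\<lambda>x. cinner (A x) y"])
      (auto simp: bounded_clinearD[OF A] cinner_algebra intro!: continuous_intros)
  then obtain B where B: "\<And>x y. cinner (A x) y = cinner x (B y)" by metis
  obtain K where K: "K > 0" "\<And>x. norm (A x) \<le> norm x * K"
    using A unfolding bounded_clinear_def by (meson bounded_linear.pos_bounded)
  have eq: "y = z" if "\<And>x. cinner x y = cinner x z" for y z :: 'a
    using that[of "y - z"] cinner_self_eq_0[of "y - z"] by (simp add: cinner_diff_right)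
  have Badd: "B (x + y) = B x + B y" for x y
    by (rule eq) (simp add: cinner_add_right flip: B)
  have Bscale: "B (scaleC c x) = scaleC c (B x)" for c x
    by (rule eq) (simp add: cinner_scaleC_right flip: B)
  have "norm (B y) \<le> norm y * K" for y
  proof (cases "B y = 0")
    case False
    have "(norm (B y))\<^sup>2 = norm (cinner (A (B y)) y)"
      by (simp add: B cinner_self norm_power)
    also have "\<dots> \<le> norm (A (B y)) * norm y"
      by (rule Cauchy_Schwarz_cinner)
    also have "\<dots> \<le> norm (B y) * K * norm y"
      using K by (intro mult_right_mono) auto
    finally show ?thesis
      using False by (simp add: power2_eq_square mult.assoc mult.commute)
  qed (use K in simp)
  then have "bounded_linear B"
    by (intro bounded_linear_intro[where K = K]) (simp_all add: Badd scaleR_scaleC Bscale)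
  then show ?thesis
    by (intro that[of B]) (auto simp: bounded_clinear_def Bscale B)
qed

lemma cinner_cadjoint:
  fixes A :: "'a :: complex_hilbert \<Rightarrow> 'a"
  assumes "bounded_clinear A"
  shows "cinner (A x) y = cinner x (cadjoint A y)"
proof -
  have "\<exists>B. bounded_clinear B \<and> (\<forall>x y. cinner (A x) y = cinner x (B y))"
    using cadjoint_exists[OF assms] by metis
  from someI_ex[OF this] show ?thesis
    unfolding cadjoint_def by blast
qed

section \<open>The Hilbert space of pairs\<close>

text \<open>
  Graphs of unbounded operators are subspaces of the space of pairs, and projections onto them
  replace the functional calculus of the operator.
\<close>

instantiation prod :: (complex_inner, complex_inner) complex_inner
begin
definition scaleC_prod_def: "scaleC c x = (scaleC c (fst x), scaleC c (snd x))"
definition cinner_prod_def: "cinner x y = cinner (fst x) (fst y) + cinner (snd x) (snd y)"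
instance
proof
  fix x y :: "'a \<times> 'b"
  show "cinner x x = complex_of_real ((norm x)\<^sup>2)"
    by (simp add: cinner_prod_def cinner_self norm_prod_def)
  show "cinner x y = cnj (cinner y x)"
    using cinner_commute[of "fst x"] cinner_commute[of "snd x"]
    by (simp add: cinner_prod_def)
qed (auto simp: scaleC_prod_def cinner_prod_def cinner_algebra scaleC_add_right scaleC_add_left
    scaleC_scaleC scaleC_one scaleR_scaleC algebra_simps scaleR_prod_def)
end

instance prod :: (complex_hilbert, complex_hilbert) complex_hilbert ..

lemma scaleC_Pair [simp]: "scaleC c (x, y) = (scaleC c x, scaleC c y)"
  by (simp add: scaleC_prod_def)

lemma cinner_Pair [simp]: "cinner (x, y) (x', y') = cinner x x' + cinner y y'"
  by (simp add: cinner_prod_def)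

lemma bounded_clinear_map_prod:
  assumes "bounded_clinear A" "bounded_clinear B"
  shows "bounded_clinear (map_prod A B)"
  using assms unfolding bounded_clinear_def map_prod_def case_prod_beta
  by (auto intro!: bounded_linear_Pair bounded_linear_compose[of A] bounded_linear_compose[of B]
      bounded_linear_fst bounded_linear_snd)

section \<open>Antiunitary maps defined on a total family\<close>

text \<open>
  The graph of \<open>S\<close> is generated from the pairs \<open>(e i, f i)\<close> by limits, sums and the scalar
  action that is twisted by conjugation in the second component. On generators the relation
  between the two inner products is the hypothesis; it is sesquilinear and continuous, hence it
  holds on the whole graph. It makes the graph single-valued and its domain complete, and the
  domain contains the total family \<open>e\<close>.
\<close>

lemma antiunitary_extension:
  fixes e f :: "'i \<Rightarrow> 'a :: complex_hilbert"
  assumes inner: "\<And>i j. i \<in> I \<Longrightarrow> j \<in> I \<Longrightarrow> cinner (e i) (e j) = cinner (f j) (f i)"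
    and total: "closure (cspan (e ` I)) = UNIV"
  shows "\<exists>S. (\<forall>x y. S (x + y) = S x + S y) \<and> (\<forall>c x. S (scaleC c x) = scaleC (cnj c) (S x)) \<and>
    (\<forall>x y. cinner (S x) (S y) = cinner y x) \<and> (\<forall>i\<in>I. S (e i) = f i)"
proof -
  define twisted where "twisted W \<longleftrightarrow> closed W \<and> 0 \<in> W \<and> (\<forall>a\<in>W. \<forall>b\<in>W. a + b \<in> W) \<and>
    (\<forall>c. \<forall>a\<in>W. (scaleC c (fst a), scaleC (cnj c) (snd a)) \<in> W)" for W :: "('a \<times> 'a) set"
  define D where "D = (\<lambda>i. (e i, f i)) ` I"
  define Gr where "Gr = \<Inter> {W. twisted W \<and> D \<subseteq> W}"
  have min: "Gr \<subseteq> W" if "D \<subseteq> W" "twisted W" for W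
    unfolding Gr_def using that by blast
  have D: "D \<subseteq> Gr"
    unfolding Gr_def by blast
  have tw: "twisted Gr"
    unfolding Gr_def twisted_def by auto
  then have closed: "closed Gr" and zero: "(0, 0) \<in> Gr"
    and add: "\<And>x y x' y'. (x, y) \<in> Gr \<Longrightarrow> (x', y') \<in> Gr \<Longrightarrow> (x + x', y + y') \<in> Gr"
    unfolding twisted_def zero_prod_def using add_Pair by metis+
  have scale: "(scaleC c x, scaleC (cnj c) y) \<in> Gr" if "(x, y) \<in> Gr" for c x y
    using tw that unfolding twisted_def by (metis fst_conv snd_conv)
  have diff: "(x - x', y - y') \<in> Gr" if "(x, y) \<in> Gr" "(x', y') \<in> Gr" for x y x' y'
  proof -
    have "scaleC (- 1) z = - z" for z :: 'a
      using scaleR_scaleC[of "- 1" z] by simp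
    then show ?thesis
      using add[OF that(1) scale[OF that(2), of "- 1"]] by simp
  qed
  have D_inner: "cinner (fst a) (fst b) = cinner (snd b) (snd a)" if "a \<in> Gr" "b \<in> D" for a b
  proof -
    have "Gr \<subseteq> {a. cinner (fst a) (fst b) = cinner (snd b) (snd a)}"
    proof (rule min)
      show "twisted {a. cinner (fst a) (fst b) = cinner (snd b) (snd a)}"
        unfolding twisted_def
        by (auto simp: cinner_algebra intro!: closed_Collect_eq continuous_intros)
    qed (use that inner in \<open>auto simp: D_def\<close>)
    then show ?thesis using that by blast
  qed
  have Gr_inner: "cinner (fst a) (fst b) = cinner (snd b) (snd a)" if "a \<in> Gr" "b \<in> Gr" for a b
  proof -
    have "Gr \<subseteq> {b. cinner (fst a) (fst b) = cinner (snd b) (snd a)}"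
    proof (rule min)
      show "twisted {b. cinner (fst a) (fst b) = cinner (snd b) (snd a)}"
        unfolding twisted_def
        by (auto simp: cinner_algebra intro!: closed_Collect_eq continuous_intros)
    qed (use that D_inner in auto)
    then show ?thesis using that by blast
  qed
  have norm: "norm y = norm x" if "(x, y) \<in> Gr" for x y
    using Gr_inner[OF that that] by (simp add: cinner_self flip: of_real_power)
  have unique: "y = y'" if "(x, y) \<in> Gr" "(x, y') \<in> Gr" for x y y'
    using norm[OF diff[OF that]] by simp
  have "closed (fst ` Gr)"
    unfolding closed_sequential_limits
  proof (intro allI impI, elim conjE)
    fix X x assume X: "\<forall>n. X n \<in> fst ` Gr" "X \<longlonglongrightarrow> x"
    then have "\<forall>n. \<exists>y. (X n, y) \<in> Gr" by force
    then obtain Y where Y: "\<And>n. (X n, Y n) \<in> Gr" by metis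
    have "dist (Y m) (Y n) = dist (X m) (X n)" for m n
      unfolding dist_norm by (rule norm[OF diff[OF Y Y]])
    then have "Cauchy Y"
      using LIMSEQ_imp_Cauchy[OF X(2)] by (simp add: Cauchy_def)
    then obtain y where "Y \<longlonglongrightarrow> y"
      using Cauchy_convergent convergent_def by blast
    then have "(x, y) \<in> Gr"
      using closed_sequentially[OF closed, of "\<lambda>n. (X n, Y n)"] Y tendsto_Pair[OF X(2)] by blast
    then show "x \<in> fst ` Gr" by force
  qed
  moreover have "csubspace (fst ` Gr)"
  proof (rule csubspaceI)
    show "0 \<in> fst ` Gr" using zero by force
    show "x + y \<in> fst ` Gr" if "x \<in> fst ` Gr" "y \<in> fst ` Gr" for x y
      using that add by (auto simp: image_iff) force
    show "scaleC c x \<in> fst ` Gr" if "x \<in> fst ` Gr" for c x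
      using that scale by (auto simp: image_iff) force
  qed
  moreover have "e ` I \<subseteq> fst ` Gr"
    using D by (force simp: D_def)
  ultimately have "fst ` Gr = UNIV"
    using closure_cspan_minimal[of "fst ` Gr" "e ` I"] total by blast
  then have "\<forall>x. \<exists>y. (x, y) \<in> Gr"
    by (metis UNIV_I fst_conv imageE prod.collapse)
  then obtain S where S: "\<And>x. (x, S x) \<in> Gr" by metis
  show ?thesis
  proof (intro exI[of _ S] conjI allI ballI)
    show "S (x + y) = S x + S y" for x y
      using unique[OF S add[OF S S]] .
    show "S (scaleC c x) = scaleC (cnj c) (S x)" for c x
      using unique[OF S scale[OF S]] .
    show "cinner (S x) (S y) = cinner y x" for x y
      using Gr_inner[OF S S, of y x] by simp
    show "S (e i) = f i" if "i \<in> I" for i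
      using unique[OF S] D that by (auto simp: D_def)
  qed
qed

section \<open>Cyclic representations with a tracial vector\<close>

text \<open>
  As \<open>chi\<close> is a class function, its GNS representation carries a second, commuting action of
  the group, which in the next locale is obtained by conjugating with the involution.
\<close>

locale tracial_gns = group G for G (structure) +
  fixes T :: "'g topology" and chi :: "'g \<Rightarrow> complex"
    and \<pi> :: "'g \<Rightarrow> 'h :: complex_hilbert \<Rightarrow> 'h" and \<xi> :: 'h
  assumes gns: "gns_triple G T chi \<pi> \<xi>"
    and class_function: "\<lbrakk>g \<in> carrier G; h \<in> carrier G\<rbrakk> \<Longrightarrow> chi (g \<otimes> h) = chi (h \<otimes> g)"
begin

lemma unitary_rep: "unitary_rep G T UNIV \<pi>"
  using gns by (simp add: gns_triple_def)

lemma norm_xi [simp]: "norm \<xi> = 1"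
  using gns by (simp add: gns_triple_def)

lemma chi_eq: "g \<in> carrier G \<Longrightarrow> chi g = cinner (\<pi> g \<xi>) \<xi>"
  using gns by (simp add: gns_triple_def)

lemma rep_continuous: "continuous_map T euclidean (\<lambda>g. \<pi> g x)"
  using unitary_rep by (simp add: unitary_rep_def)

lemma rep_unitary:
  assumes "g \<in> carrier G"
  shows rep_add: "\<pi> g (x + y) = \<pi> g x + \<pi> g y"
    and rep_scaleC: "\<pi> g (scaleC c x) = scaleC c (\<pi> g x)"
    and rep_cinner: "cinner (\<pi> g x) (\<pi> g y) = cinner x y"
  using unitary_rep assms by (auto simp: unitary_rep_def unitary_on_def)

lemma rep_mult: "\<lbrakk>g \<in> carrier G; h \<in> carrier G\<rbrakk> \<Longrightarrow> \<pi> (g \<otimes> h) x = \<pi> g (\<pi> h x)"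
  using unitary_rep by (simp add: unitary_rep_def)

lemma rep_diff: "g \<in> carrier G \<Longrightarrow> \<pi> g (x - y) = \<pi> g x - \<pi> g y"
  using rep_add[of g "x - y" y] by simp

lemma norm_rep: "g \<in> carrier G \<Longrightarrow> norm (\<pi> g x) = norm x"
  using rep_cinner[of g x x] by (simp add: cinner_self flip: of_real_power)

lemma rep_bounded_clinear: "g \<in> carrier G \<Longrightarrow> bounded_clinear (\<pi> g)"
  unfolding bounded_clinear_def
  by (auto simp: rep_add rep_scaleC norm_rep scaleR_scaleC intro!: bounded_linear_intro[where K = 1])

lemma rep_one: "\<pi> \<one> x = x"
proof -
  have "\<pi> \<one> (\<pi> \<one> x - x) = 0"
    using rep_mult[of \<one> \<one> x] by (simp add: rep_diff)
  then show ?thesis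
    using norm_rep[of \<one> "\<pi> \<one> x - x"] by simp
qed

lemma rep_inv: "g \<in> carrier G \<Longrightarrow> \<pi> (inv g) (\<pi> g x) = x"
  using rep_mult[of "inv g" g x] by (simp add: rep_one)

lemma rep_adjoint: "g \<in> carrier G \<Longrightarrow> cinner (\<pi> g x) y = cinner x (\<pi> (inv g) y)"
  using rep_cinner[of "inv g" "\<pi> g x" y] by (simp add: rep_inv)

lemma cyclic:
  assumes "closed W" "csubspace W" "\<And>g. g \<in> carrier G \<Longrightarrow> \<pi> g \<xi> \<in> W"
  shows "x \<in> W"
proof -
  have "closure (cspan ((\<lambda>g. \<pi> g \<xi>) ` carrier G)) \<subseteq> W"
    using assms by (intro closure_cspan_minimal) auto
  then show ?thesis
    using gns by (auto simp: gns_triple_def)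
qed

lemma orthogonal_orbit:
  assumes "\<And>g. g \<in> carrier G \<Longrightarrow> cinner x (\<pi> g \<xi>) = 0"
  shows "x = 0"
proof -
  have "x \<in> {y. cinner x y = 0}"
  proof (rule cyclic)
    show "closed {y. cinner x y = 0}"
      by (intro closed_Collect_eq continuous_intros)
    show "csubspace {y. cinner x y = 0}"
      by (rule csubspaceI) (simp_all add: cinner_algebra)
  qed (use assms in auto)
  then have "cinner x x = 0" by simp
  then show ?thesis by (rule cinner_self_eq_0)
qed

lemma bounded_clinear_eqI:
  assumes A: "bounded_clinear A" and B: "bounded_clinear B"
    and "\<And>g. g \<in> carrier G \<Longrightarrow> A (\<pi> g \<xi>) = B (\<pi> g \<xi>)"
  shows "A x = B x"
proof -
  have "x \<in> {x. A x = B x}"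
  proof (rule cyclic)
    show "closed {x. A x = B x}"
      by (intro closed_Collect_eq bounded_clinearD A B)
    show "csubspace {x. A x = B x}"
      using bounded_clinearD(2)[OF A, of 0] bounded_clinearD(2)[OF B, of 0]
      by (intro csubspaceI) (auto simp: bounded_clinearD(1,2)[OF A] bounded_clinearD(1,2)[OF B])
  qed (use assms in auto)
  then show ?thesis by simp
qed

lemma orbit_cinner:
  assumes "g \<in> carrier G" "h \<in> carrier G"
  shows "cinner (\<pi> g \<xi>) (\<pi> h \<xi>) = chi (inv h \<otimes> g)"
proof -
  have "cinner (\<pi> g \<xi>) (\<pi> h \<xi>) = cinner (\<pi> (inv h) (\<pi> g \<xi>)) \<xi>"
    using assms by (simp add: rep_adjoint)
  then show ?thesis
    using assms by (simp add: chi_eq rep_mult)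
qed

end

text \<open>
  The involution enters only through its values on the orbit of \<open>\<xi>\<close> and its antiunitarity.
  Keeping it as a parameter allows the properties of the right action to be used before the
  involution is identified with \<open>gns_involution\<close>; indeed that identification depends on them.
\<close>

locale tracial_gns_conjugation = tracial_gns G T chi \<pi> \<xi>
  for G (structure) and T :: "'g topology" and chi :: "'g \<Rightarrow> complex"
    and \<pi> :: "'g \<Rightarrow> 'h :: complex_hilbert \<Rightarrow> 'h" and \<xi> :: 'h +
  fixes S :: "'h \<Rightarrow> 'h"
  assumes conj_add: "S (x + y) = S x + S y"
    and conj_scaleC: "S (scaleC c x) = scaleC (cnj c) (S x)"
    and conj_cinner: "cinner (S x) (S y) = cinner y x"
    and conj_orbit: "g \<in> carrier G \<Longrightarrow> S (\<pi> g \<xi>) = \<pi> (inv g) \<xi>"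
begin

lemma norm_conj: "norm (S x) = norm x"
  using conj_cinner[of x x] by (simp add: cinner_self flip: of_real_power)

lemma conj_zero: "S 0 = 0"
  using conj_add[of 0 0] by simp

lemma conj_continuous: "continuous_on UNIV S"
  by (rule bounded_linear.continuous_on[OF bounded_linear_intro[where K = 1]])
    (auto simp: conj_add conj_scaleC norm_conj scaleR_scaleC)

lemma conj_conj: "S (S x) = x"
proof -
  have "x \<in> {x. S (S x) = x}"
  proof (rule cyclic)
    show "closed {x. S (S x) = x}"
      by (intro closed_Collect_eq continuous_on_compose2[OF conj_continuous conj_continuous]
          continuous_intros) auto
    show "csubspace {x. S (S x) = x}"
      by (rule csubspaceI) (auto simp: conj_add conj_scaleC conj_zero)
  qed (simp add: conj_orbit)
  then show ?thesis by simp
qed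

definition right_rep :: "'g \<Rightarrow> 'h \<Rightarrow> 'h" where
  "right_rep g x = S (\<pi> g (S x))"

abbreviation conjugation_rep :: "'g \<Rightarrow> 'h \<Rightarrow> 'h" where
  "conjugation_rep g x \<equiv> \<pi> g (right_rep g x)"

lemma right_rep_bounded_clinear: "g \<in> carrier G \<Longrightarrow> bounded_clinear (right_rep g)"
  unfolding bounded_clinear_def
  by (auto simp: right_rep_def rep_add rep_scaleC conj_add conj_scaleC norm_rep norm_conj scaleR_scaleC
      intro!: bounded_linear_intro[where K = 1])

lemma right_rep_mult:
  "\<lbrakk>g \<in> carrier G; h \<in> carrier G\<rbrakk> \<Longrightarrow> right_rep (g \<otimes> h) x = right_rep g (right_rep h x)"
  by (simp add: right_rep_def conj_conj rep_mult)

lemma right_rep_one: "right_rep \<one> x = x"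
  by (simp add: right_rep_def conj_conj rep_one)

lemma right_rep_adjoint:
  assumes "g \<in> carrier G"
  shows "cinner (right_rep g x) y = cinner x (right_rep (inv g) y)"
proof -
  have "cinner (right_rep g x) y = cinner (S y) (\<pi> g (S x))"
    using conj_cinner[of "\<pi> g (S x)" "S y"] by (simp add: right_rep_def conj_conj)
  also have "\<dots> = cinner (\<pi> (inv g) (S y)) (S x)"
    using assms by (simp add: rep_adjoint)
  also have "\<dots> = cinner x (right_rep (inv g) y)"
    using conj_cinner[of "S x" "\<pi> (inv g) (S y)"] by (simp add: right_rep_def conj_conj)
  finally show ?thesis .
qed

lemma right_rep_orbit:
  "\<lbrakk>g \<in> carrier G; h \<in> carrier G\<rbrakk> \<Longrightarrow> right_rep g (\<pi> h \<xi>) = \<pi> (h \<otimes> inv g) \<xi>"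
  by (simp add: right_rep_def conj_orbit inv_mult_group flip: rep_mult)

lemma right_rep_commute:
  assumes g: "g \<in> carrier G" and h: "h \<in> carrier G"
  shows "right_rep g (\<pi> h x) = \<pi> h (right_rep g x)"
proof (rule bounded_clinear_eqI[of "\<lambda>x. right_rep g (\<pi> h x)" "\<lambda>x. \<pi> h (right_rep g x)"])
  \<comment> \<open>On the orbit of \<open>\<xi>\<close> the two operators are right and left multiplication.\<close>
  fix k assume "k \<in> carrier G"
  then show "right_rep g (\<pi> h (\<pi> k \<xi>)) = \<pi> h (right_rep g (\<pi> k \<xi>))"
    using g h by (simp add: right_rep_orbit m_assoc flip: rep_mult)
qed (rule bounded_clinear_compose[OF right_rep_bounded_clinear[OF g] rep_bounded_clinear[OF h]]
    bounded_clinear_compose[OF rep_bounded_clinear[OF h] right_rep_bounded_clinear[OF g]])+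

lemma right_rep_xi: "g \<in> carrier G \<Longrightarrow> right_rep g \<xi> = \<pi> (inv g) \<xi>"
  using right_rep_orbit[of g \<one>] by (simp add: rep_one)

lemma conjugation_rep_adjoint:
  "g \<in> carrier G \<Longrightarrow> cinner (conjugation_rep g x) y = cinner x (conjugation_rep (inv g) y)"
  by (simp add: rep_adjoint right_rep_adjoint right_rep_commute)

lemma conjugation_rep_mult:
  "\<lbrakk>g \<in> carrier G; h \<in> carrier G\<rbrakk>
    \<Longrightarrow> conjugation_rep (g \<otimes> h) x = conjugation_rep g (conjugation_rep h x)"
  by (simp add: rep_mult right_rep_mult right_rep_commute)

lemma conjugation_rep_orbit:
  "\<lbrakk>g \<in> carrier G; h \<in> carrier G\<rbrakk> \<Longrightarrow> conjugation_rep g (\<pi> h \<xi>) = \<pi> (g \<otimes> h \<otimes> inv g) \<xi>"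
  by (simp add: right_rep_orbit m_assoc flip: rep_mult)

text \<open>
  The right action lies in the commutant of \<open>\<pi>\<close>, so an element \<open>b\<close> of the bicommutant
  commutes with it. Since \<open>\<pi> g \<xi>\<close> is also the image of \<open>\<xi>\<close> under the right action of
  \<open>inv g\<close>, comparing both sides with the orbit of \<open>\<xi>\<close> gives the identity for every such \<open>b\<close>,
  without approximating \<open>b\<close> by linear combinations of group elements.
\<close>

lemma conj_generated_vN:
  assumes b: "b \<in> generated_vN G \<pi>"
  shows "S (b \<xi>) = cadjoint b \<xi>"
proof -
  have bc: "bounded_clinear b" and comm: "\<And>A. A \<in> commutant (\<pi> ` carrier G) \<Longrightarrow> b \<circ> A = A \<circ> b"
    using b by (auto simp: generated_vN_def commutant_def)
  have "S (b \<xi>) - cadjoint b \<xi> = 0"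
  proof (rule orthogonal_orbit)
    fix g assume g: "g \<in> carrier G"
    have R: "right_rep h \<in> commutant (\<pi> ` carrier G)" if "h \<in> carrier G" for h
      using that by (auto simp: commutant_def right_rep_bounded_clinear right_rep_commute fun_eq_iff)
    have "b (right_rep (inv g) \<xi>) = right_rep (inv g) (b \<xi>)"
      using comm[OF R[of "inv g"]] g by (auto simp: fun_eq_iff)
    then have bg: "b (\<pi> g \<xi>) = right_rep (inv g) (b \<xi>)"
      using g by (simp add: right_rep_xi)
    have "cinner (S (b \<xi>)) (\<pi> g \<xi>) = cinner (S (b \<xi>)) (S (\<pi> (inv g) \<xi>))"
      using g by (simp add: conj_orbit)
    also have "\<dots> = cinner (right_rep g \<xi>) (b \<xi>)"
      using g by (simp add: conj_cinner right_rep_xi)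
    also have "\<dots> = cinner \<xi> (b (\<pi> g \<xi>))"
      using g by (simp add: right_rep_adjoint bg)
    also have "\<dots> = cnj (cinner (\<pi> g \<xi>) (cadjoint b \<xi>))"
      by (metis cinner_cadjoint[OF bc] cinner_commute)
    finally show "cinner (S (b \<xi>) - cadjoint b \<xi>) (\<pi> g \<xi>) = 0"
      by (simp add: cinner_diff_left flip: cinner_commute)
  qed
  then show ?thesis by simp
qed

end

context tracial_gns
begin

lemma rep_generated_vN: "g \<in> carrier G \<Longrightarrow> \<pi> g \<in> generated_vN G \<pi>"
  unfolding generated_vN_def commutant_def by (simp add: rep_bounded_clinear)

lemma cadjoint_rep:
  assumes "g \<in> carrier G"
  shows "cadjoint (\<pi> g) y = \<pi> (inv g) y"
proof -
  have "cinner x (cadjoint (\<pi> g) y - \<pi> (inv g) y) = 0" for x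
    using assms by (simp add: cinner_diff_right rep_adjoint
        flip: cinner_cadjoint[OF rep_bounded_clinear])
  then have "cadjoint (\<pi> g) y - \<pi> (inv g) y = 0"
    by (rule cinner_self_eq_0)
  then show ?thesis by simp
qed

text \<open>
  The description that defines \<open>gns_involution\<close> has exactly one solution. Existence: since
  \<open>chi\<close> is a class function, \<open>\<pi> g \<xi> \<mapsto> \<pi> (inv g) \<xi>\<close> reverses inner products and extends to
  an antiunitary map, which acts as the adjoint on the whole von Neumann algebra. Uniqueness:
  the description fixes the values on the total orbit of \<open>\<xi>\<close>.
\<close>

lemma gns_involution_conjugation:
  "tracial_gns_conjugation G T chi \<pi> \<xi> (gns_involution G \<pi> \<xi>)"
proof -
  have inner: "cinner (\<pi> g \<xi>) (\<pi> h \<xi>) = cinner (\<pi> (inv h) \<xi>) (\<pi> (inv g) \<xi>)"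
    if "g \<in> carrier G" "h \<in> carrier G" for g h
    using that class_function[of "inv h" g] by (simp add: orbit_cinner)
  have "closure (cspan ((\<lambda>g. \<pi> g \<xi>) ` carrier G)) = UNIV"
    using gns by (simp add: gns_triple_def)
  from antiunitary_extension[OF inner this] obtain S where S: "\<forall>x y. S (x + y) = S x + S y"
    "\<forall>c x. S (scaleC c x) = scaleC (cnj c) (S x)" "\<forall>x y. cinner (S x) (S y) = cinner y x"
    "\<forall>g\<in>carrier G. S (\<pi> g \<xi>) = \<pi> (inv g) \<xi>"
    by auto
  interpret S: tracial_gns_conjugation G T chi \<pi> \<xi> S
    by unfold_locales (simp_all add: S)
  have "gns_involution G \<pi> \<xi> = S"
    unfolding gns_involution_def
  proof (rule the_equality)
    show "(\<forall>x y. S (x + y) = S x + S y) \<and> (\<forall>c x. S (scaleC c x) = scaleC (cnj c) (S x)) \<and>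
      (\<forall>x. S (S x) = x) \<and> (\<forall>x. norm (S x) = norm x) \<and>
      (\<forall>b\<in>generated_vN G \<pi>. S (b \<xi>) = cadjoint b \<xi>)"
      using S by (intro conjI allI ballI S.conj_conj S.norm_conj S.conj_generated_vN) auto
  next
    fix S'
    assume S': "(\<forall>x y. S' (x + y) = S' x + S' y) \<and> (\<forall>c x. S' (scaleC c x) = scaleC (cnj c) (S' x)) \<and>
      (\<forall>x. S' (S' x) = x) \<and> (\<forall>x. norm (S' x) = norm x) \<and>
      (\<forall>b\<in>generated_vN G \<pi>. S' (b \<xi>) = cadjoint b \<xi>)"
    then have add: "S' (x + y) = S' x + S' y" and scale: "S' (scaleC c x) = scaleC (cnj c) (S' x)"
      and norm: "norm (S' x) = norm x" for c x y
      by blast+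
    have orbit: "S' (\<pi> g \<xi>) = \<pi> (inv g) \<xi>" if "g \<in> carrier G" for g
      using S' rep_generated_vN[OF that] cadjoint_rep[OF that, of \<xi>] by metis
    have cont: "continuous_on UNIV S'"
      by (rule bounded_linear.continuous_on[OF bounded_linear_intro[where K = 1]])
        (auto simp: scaleR_scaleC add scale norm)
    have "x \<in> {x. S' x = S x}" for x
    proof (rule cyclic)
      show "closed {x. S' x = S x}"
        by (intro closed_Collect_eq cont S.conj_continuous)
      show "csubspace {x. S' x = S x}"
        using norm[of 0] by (intro csubspaceI) (auto simp: S add scale S.conj_zero)
      show "\<pi> g \<xi> \<in> {x. S' x = S x}" if "g \<in> carrier G" for g
        using that by (simp add: S orbit)
    qed
    then show "S' = S" by auto
  qed
  then show ?thesis
    by (simp add: S.tracial_gns_conjugation_axioms)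
qed

end

section \<open>Finite traces and indecomposable characters\<close>

text \<open>
  The cone over the characters. Unlike the set of characters it is closed under sums, and it
  contains the vector states that arise when a character is split.
\<close>

definition finite_trace :: "('g, 'b) monoid_scheme \<Rightarrow> 'g topology \<Rightarrow> ('g \<Rightarrow> complex) \<Rightarrow> bool" where
  "finite_trace G T \<psi> \<longleftrightarrow> continuous_map T euclidean \<psi> \<and> positive_definite G \<psi> \<and>
     (\<forall>g\<in>carrier G. \<forall>h\<in>carrier G. \<psi> (g \<otimes>\<^bsub>G\<^esub> h) = \<psi> (h \<otimes>\<^bsub>G\<^esub> g))"

lemma character_iff_finite_trace:
  "character G T chi \<longleftrightarrow> finite_trace G T chi \<and> chi \<one>\<^bsub>G\<^esub> = 1"
  by (auto simp: character_def finite_trace_def)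

lemma positive_definiteD:
  fixes m :: nat
  assumes "positive_definite G \<psi>" "\<And>i. i < m \<Longrightarrow> g i \<in> carrier G"
  shows "(\<Sum>i<m. \<Sum>j<m. c i * cnj (c j) * \<psi> (inv\<^bsub>G\<^esub> (g j) \<otimes>\<^bsub>G\<^esub> g i)) \<in> \<real>\<^sub>\<ge>\<^sub>0"
  using assms unfolding positive_definite_def by blast

lemma positive_definite_one:
  assumes "group G" "positive_definite G \<psi>"
  shows "\<psi> \<one>\<^bsub>G\<^esub> \<in> \<real>\<^sub>\<ge>\<^sub>0"
proof -
  interpret group G by fact
  show ?thesis
    using positive_definiteD[OF assms(2), of 1 "\<lambda>_. \<one>\<^bsub>G\<^esub>" "\<lambda>_. 1"] by simp
qed

text \<open>
  For the points \<open>1\<close> and \<open>g\<close> the quadratic form reduces to its off-diagonal part. This must be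
  nonnegative for all coefficients, and replacing one coefficient by its negative shows that it
  vanishes.
\<close>

lemma positive_definite_eq_0:
  assumes G: "group G" and pd: "positive_definite G \<psi>" and 0: "\<psi> \<one>\<^bsub>G\<^esub> = 0" and g: "g \<in> carrier G"
  shows "\<psi> g = 0"
proof -
  interpret group G by fact
  have *: "a * cnj b * \<psi> (inv\<^bsub>G\<^esub> g) + b * cnj a * \<psi> g \<in> \<real>\<^sub>\<ge>\<^sub>0" for a b
    using positive_definiteD[OF pd, of 2 "\<lambda>i. if i = 0 then \<one>\<^bsub>G\<^esub> else g" "\<lambda>i. if i = 0 then a else b"] g 0
    by (simp add: numeral_2_eq_2 add.commute)
  have "\<psi> (inv\<^bsub>G\<^esub> g) + \<psi> g = 0"
    using *[of 1 1] *[of 1 "- 1"] by (auto simp: complex_nonneg_Reals_iff complex_eq_iff)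
  moreover have "\<psi> g - \<psi> (inv\<^bsub>G\<^esub> g) = 0"
    using *[of 1 \<i>] *[of 1 "- \<i>"] by (auto simp: complex_nonneg_Reals_iff complex_eq_iff)
  ultimately show ?thesis by simp
qed

lemma finite_trace_add:
  assumes "finite_trace G T \<psi>\<^sub>1" "finite_trace G T \<psi>\<^sub>2"
  shows "finite_trace G T (\<lambda>g. \<psi>\<^sub>1 g + \<psi>\<^sub>2 g)"
proof -
  have "positive_definite G (\<lambda>g. \<psi>\<^sub>1 g + \<psi>\<^sub>2 g)"
    unfolding positive_definite_def
  proof (intro allI impI)
    fix m :: nat and c g assume "\<forall>i<m. g i \<in> carrier G"
    then show "(\<Sum>i<m. \<Sum>j<m. c i * cnj (c j) * (\<psi>\<^sub>1 (inv\<^bsub>G\<^esub> (g j) \<otimes>\<^bsub>G\<^esub> g i) + \<psi>\<^sub>2 (inv\<^bsub>G\<^esub> (g j) \<otimes>\<^bsub>G\<^esub> g i))) \<in> \<real>\<^sub>\<ge>\<^sub>0"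
      using nonneg_Reals_add_I[OF positive_definiteD[of G \<psi>\<^sub>1 m g c] positive_definiteD[of G \<psi>\<^sub>2 m g c]] assms
      by (simp add: finite_trace_def sum.distrib distrib_left)
  qed
  moreover have "continuous_map T euclidean (\<lambda>g. \<psi>\<^sub>1 g + \<psi>\<^sub>2 g)"
    using assms by (intro continuous_map_add) (auto simp: finite_trace_def)
  ultimately show ?thesis
    using assms by (simp add: finite_trace_def)
qed

lemma finite_trace_scale:
  assumes "finite_trace G T \<psi>" "r \<ge> 0"
  shows "finite_trace G T (\<lambda>g. complex_of_real r * \<psi> g)"
proof -
  have "positive_definite G (\<lambda>g. complex_of_real r * \<psi> g)"
    unfolding positive_definite_def
  proof (intro allI impI)
    fix m :: nat and c g assume "\<forall>i<m. g i \<in> carrier G"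
    then show "(\<Sum>i<m. \<Sum>j<m. c i * cnj (c j) * (complex_of_real r * \<psi> (inv\<^bsub>G\<^esub> (g j) \<otimes>\<^bsub>G\<^esub> g i))) \<in> \<real>\<^sub>\<ge>\<^sub>0"
      using nonneg_Reals_mult_I[OF _ positive_definiteD[of G \<psi> m g c], of "complex_of_real r"] assms
      by (simp add: finite_trace_def sum_distrib_left mult_ac)
  qed
  moreover have "continuous_map T euclidean (\<lambda>g. complex_of_real r * \<psi> g)"
    using assms continuous_map_compose[of T euclidean \<psi> euclidean "\<lambda>z. complex_of_real r * z"]
    by (simp add: finite_trace_def o_def continuous_intros)
  ultimately show ?thesis
    using assms by (simp add: finite_trace_def)
qed

text \<open>
  The normalised summands are characters, so indecomposability makes them equal and hence both
  equal to \<open>chi\<close>. Normalising fails when one summand vanishes at the identity, but then that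
  summand is zero.
\<close>

lemma indecomposable_character_summand:
  assumes G: "group G" and indec: "indecomposable_character G T chi"
    and tr: "finite_trace G T \<psi>\<^sub>1" "finite_trace G T \<psi>\<^sub>2"
    and sum: "\<And>g. g \<in> carrier G \<Longrightarrow> chi g = \<psi>\<^sub>1 g + \<psi>\<^sub>2 g"
    and g: "g \<in> carrier G"
  shows "\<psi>\<^sub>1 g = \<psi>\<^sub>1 \<one>\<^bsub>G\<^esub> * chi g"
proof -
  interpret group G by fact
  have pd: "positive_definite G \<psi>\<^sub>1" "positive_definite G \<psi>\<^sub>2"
    using tr by (auto simp: finite_trace_def)
  obtain r s where r: "\<psi>\<^sub>1 \<one>\<^bsub>G\<^esub> = complex_of_real r" "r \<ge> 0" and s: "\<psi>\<^sub>2 \<one>\<^bsub>G\<^esub> = complex_of_real s" "s \<ge> 0"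
    using pd[THEN positive_definite_one[OF G]] by (auto elim!: nonneg_Reals_cases)
  have "complex_of_real (r + s) = 1"
    using sum[of "\<one>\<^bsub>G\<^esub>"] indec r s by (simp add: indecomposable_character_def character_def)
  then have s': "s = 1 - r"
    by (simp flip: of_real_add)
  consider "r = 0" | "s = 0" | "r > 0" "s > 0"
    using r s by linarith
  then show ?thesis
  proof cases
    case 1
    then show ?thesis using positive_definite_eq_0[OF G pd(1) _ g] r by simp
  next
    case 2
    then show ?thesis using positive_definite_eq_0[OF G pd(2) _ g] r s s' sum[OF g] by simp
  next
    case 3
    let ?chi1 = "\<lambda>g. complex_of_real (1 / r) * \<psi>\<^sub>1 g" and ?chi2 = "\<lambda>g. complex_of_real (1 / s) * \<psi>\<^sub>2 g"
    have char: "character G T ?chi1" "character G T ?chi2"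
      using 3 r s by (auto simp: character_iff_finite_trace simp del: of_real_divide
          intro!: finite_trace_scale tr simp flip: of_real_mult)
    have decomp: "\<forall>g\<in>carrier G. chi g = of_real r * ?chi1 g + of_real (1 - r) * ?chi2 g"
      using sum 3 by (simp flip: s')
    have "?chi1 g = ?chi2 g"
    proof (rule ccontr)
      assume "?chi1 g \<noteq> ?chi2 g"
      then have "\<exists>g\<in>carrier G. ?chi1 g \<noteq> ?chi2 g"
        using g by blast
      moreover have "0 < r" "r < 1"
        using 3 s' by simp_all
      ultimately show False
        using indec char decomp unfolding indecomposable_character_def by blast
    qed
    then have "chi g = of_real (r + s) * ?chi1 g"
      using sum[OF g] 3 by (simp add: field_simps)
    then show ?thesis
      using 3 r s' by simp
  qed
qed

section \<open>Central vectors\<close>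

context tracial_gns_conjugation
begin

text \<open>
  When the GNS space is identified with the operators that are square-integrable for the trace,
  these are the ones affiliated with the centre of the von Neumann algebra.
\<close>

definition central :: "'h \<Rightarrow> bool" where
  "central v \<longleftrightarrow> (\<forall>g\<in>carrier G. conjugation_rep g v = v)"

lemma conjugation_rep_bounded_clinear: "g \<in> carrier G \<Longrightarrow> bounded_clinear (conjugation_rep g)"
  by (rule bounded_clinear_compose[OF rep_bounded_clinear right_rep_bounded_clinear])

lemma central_xi: "central \<xi>"
  unfolding central_def using conjugation_rep_orbit[of _ \<one>] by (simp add: rep_one)

lemma central_add: "central v \<Longrightarrow> central w \<Longrightarrow> central (v + w)"
  unfolding central_def using bounded_clinearD(1)[OF conjugation_rep_bounded_clinear] by simp

lemma central_scaleC: "central v \<Longrightarrow> central (scaleC c v)"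
  unfolding central_def using bounded_clinearD(2)[OF conjugation_rep_bounded_clinear] by simp

lemma central_diff: "central v \<Longrightarrow> central w \<Longrightarrow> central (v - w)"
  using central_add[of v "scaleC (- 1) w"] central_scaleC[of w "- 1"] scaleR_scaleC[of "- 1" w]
  by simp

lemma central_right_rep:
  assumes "central v" "g \<in> carrier G"
  shows "right_rep g v = \<pi> (inv g) v"
  using assms rep_inv[of g "right_rep g v"] by (simp add: central_def)

lemma central_finite_trace:
  assumes v: "central v"
  shows "finite_trace G T (\<lambda>g. cinner (\<pi> g v) v)"
  unfolding finite_trace_def
proof (intro conjI ballI)
  show "continuous_map T euclidean (\<lambda>g. cinner (\<pi> g v) v)"
    using continuous_map_compose[OF rep_continuous[of v], of euclidean "\<lambda>x. cinner x v"]
    by (simp add: o_def continuous_intros)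
  show "positive_definite G (\<lambda>g. cinner (\<pi> g v) v)"
    unfolding positive_definite_def
  proof (intro allI impI)
    fix m :: nat and c g assume g: "\<forall>i<m. g i \<in> carrier G"
    define x where "x = (\<Sum>i<m. scaleC (c i) (\<pi> (g i) v))"
    have "(\<Sum>i<m. \<Sum>j<m. c i * cnj (c j) * cinner (\<pi> (inv (g j) \<otimes> g i) v) v)
        = (\<Sum>i<m. \<Sum>j<m. c i * cnj (c j) * cinner (\<pi> (g i) v) (\<pi> (g j) v))"
      using g by (intro sum.cong refl) (simp add: rep_mult rep_adjoint)
    also have "\<dots> = cinner x x"
      by (subst sum.swap) (simp add: x_def cinner_sum_left cinner_sum_right cinner_scaleC_left
          cinner_scaleC_right sum_distrib_left mult_ac)
    also have "\<dots> \<in> \<real>\<^sub>\<ge>\<^sub>0"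
      by (simp add: cinner_self)
    finally show "(\<Sum>i<m. \<Sum>j<m. c i * cnj (c j) * cinner (\<pi> (inv (g j) \<otimes> g i) v) v) \<in> \<real>\<^sub>\<ge>\<^sub>0" .
  qed
  fix g h assume g: "g \<in> carrier G" and h: "h \<in> carrier G"
  have "cinner (\<pi> (g \<otimes> h) v) v = cinner (\<pi> g (right_rep (inv h) v)) v"
    using g h v by (simp add: rep_mult central_right_rep)
  also have "\<dots> = cinner (\<pi> g v) (right_rep h v)"
    using g h by (simp add: right_rep_adjoint flip: right_rep_commute)
  also have "\<dots> = cinner (\<pi> (h \<otimes> g) v) v"
    using g h v by (simp add: rep_mult central_right_rep rep_adjoint)
  finally show "cinner (\<pi> (g \<otimes> h) v) v = cinner (\<pi> (h \<otimes> g) v) v" .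
qed

text \<open>
  The equivariant, possibly unbounded operator \<open>A\<close> with \<open>A (\<pi> g \<xi>) = \<pi> g v\<close> is studied
  through the closure \<open>Gr\<close> of its graph. Project \<open>(\<xi>, 0)\<close> onto \<open>Gr\<close>; formally the result
  \<open>(p, q)\<close> has \<open>p = (1 + A* A)^(-1) \<xi>\<close>. As \<open>Gr\<close> is invariant under the action and under
  conjugation, \<open>p\<close> and \<open>q\<close> are central, and the orthogonal decomposition of \<open>(\<xi>, 0)\<close> splits
  \<open>chi\<close> into two finite traces. By indecomposability the first one is a multiple of \<open>chi\<close>,
  which forces \<open>p = a \<xi>\<close>. The operator is closable, as its adjoint is defined on the orbit of
  \<open>\<xi>\<close>; hence \<open>q = a v\<close>. Orthogonality of \<open>(\<xi>, 0) - (p, q)\<close> to \<open>Gr\<close> then relates the states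
  of \<open>v\<close> and \<open>\<xi>\<close>.
\<close>

lemma central_vector_state:
  assumes indec: "indecomposable_character G T chi" and v: "central v"
  shows "\<exists>c. \<forall>g\<in>carrier G. cinner (\<pi> g v) v = c * chi g"
proof -
  define Gr where "Gr = closure (cspan ((\<lambda>g. (\<pi> g \<xi>, \<pi> g v)) ` carrier G))"
  have Gr: "closed Gr" "csubspace Gr"
    by (simp_all add: Gr_def csubspace_closure_cspan)
  have gen: "(\<pi> g \<xi>, \<pi> g v) \<in> Gr" if "g \<in> carrier G" for g
    unfolding Gr_def using that by (intro subsetD[OF closure_cspan_superset] image_eqI[OF refl])
  have invariant: "A a \<in> Gr" if "bounded_clinear A" "a \<in> Gr"
    "\<And>g. g \<in> carrier G \<Longrightarrow> A (\<pi> g \<xi>, \<pi> g v) \<in> Gr" for A a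
  proof (rule bounded_clinear_closure_cspan[OF that(1) Gr])
    show "a \<in> closure (cspan ((\<lambda>g. (\<pi> g \<xi>, \<pi> g v)) ` carrier G))"
      using that(2) by (simp only: Gr_def)
  qed (use that(3) in auto)
  have inv_rep: "(\<pi> g x, \<pi> g y) \<in> Gr" if "g \<in> carrier G" "(x, y) \<in> Gr" for g x y
    using invariant[OF bounded_clinear_map_prod[OF rep_bounded_clinear rep_bounded_clinear], of g g "(x, y)"]
      that gen by (simp flip: rep_mult)
  have inv_conj: "(conjugation_rep g x, conjugation_rep g y) \<in> Gr"
    if "g \<in> carrier G" "(x, y) \<in> Gr" for g x y
  proof -
    have "map_prod (conjugation_rep g) (conjugation_rep g) (x, y) \<in> Gr"
    proof (rule invariant[of "map_prod (conjugation_rep g) (conjugation_rep g)" "(x, y)"])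
      fix h assume h: "h \<in> carrier G"
      have "conjugation_rep g (\<pi> h v) = \<pi> (g \<otimes> h \<otimes> inv g) v"
        using that(1) h v by (simp add: right_rep_commute central_right_rep m_assoc flip: rep_mult)
      then show "map_prod (conjugation_rep g) (conjugation_rep g) (\<pi> h \<xi>, \<pi> h v) \<in> Gr"
        using that(1) h gen[of "g \<otimes> h \<otimes> inv g"] by (simp add: conjugation_rep_orbit)
    qed (use that in \<open>auto intro: bounded_clinear_map_prod conjugation_rep_bounded_clinear\<close>)
    then show ?thesis by simp
  qed
  from projection_exists[OF Gr, of "(\<xi>, 0)"]
  obtain p q where pq: "(p, q) \<in> Gr" and perp: "\<forall>w\<in>Gr. cinner ((\<xi>, 0) - (p, q)) w = 0"
    by (metis surj_pair)
  have orth: "cinner (\<xi> - p) x = cinner q y" if "(x, y) \<in> Gr" for x y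
    using bspec[OF perp that] by (simp add: cinner_minus)
  have "conjugation_rep g p = p \<and> conjugation_rep g q = q" if g: "g \<in> carrier G" for g
  proof -
    have "map_prod (conjugation_rep g) (conjugation_rep g) (p, q) = (p, q)"
    proof (rule fixed_projection[OF Gr(2) pq, of "(\<xi>, 0)"])
      show "map_prod (conjugation_rep g) (conjugation_rep g) (\<xi>, 0) = (\<xi>, 0)"
        using central_xi g bounded_clinearD(2)[OF conjugation_rep_bounded_clinear[OF g], of 0 0]
        by (simp add: central_def)
      show "cinner (map_prod (conjugation_rep g) (conjugation_rep g) y) z
          = cinner y (map_prod (conjugation_rep (inv g)) (conjugation_rep (inv g)) z)" for y z
        using conjugation_rep_adjoint[OF g] by (cases y, cases z) simp
    qed (use g orth inv_conj in \<open>auto simp: cinner_minus\<close>)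
    then show ?thesis by simp
  qed
  then have central: "central p" "central q"
    by (auto simp: central_def)
  \<comment> \<open>The cross terms of \<open>\<xi> = p + (\<xi> - p)\<close> are again the state of \<open>q\<close>.\<close>
  have pq1: "cinner (\<pi> g p) (\<xi> - p) = cinner (\<pi> g q) q" if g: "g \<in> carrier G" for g
    using orth[OF inv_rep[OF g pq]] by (metis cinner_commute)
  have pq2: "cinner (\<pi> g (\<xi> - p)) p = cinner (\<pi> g q) q" if g: "g \<in> carrier G" for g
    using orth[OF inv_rep[OF inv_closed[OF g] pq]] g by (simp add: rep_adjoint)
  have "chi g = (cinner (\<pi> g p) p + cinner (\<pi> g q) q)
      + (cinner (\<pi> g (\<xi> - p)) (\<xi> - p) + cinner (\<pi> g q) q)" if g: "g \<in> carrier G" for g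
    using pq1[OF g] pq2[OF g] g by (simp add: chi_eq rep_diff cinner_algebra algebra_simps)
  note summand = indecomposable_character_summand[OF is_group indec _ _ this]
  define a where "a = cinner p p + cinner q q"
  have a: "cinner (\<pi> g p) p + cinner (\<pi> g q) q = a * chi g" if "g \<in> carrier G" for g
    using summand[OF _ _ _ that] central central_xi
    by (simp add: a_def rep_one finite_trace_add central_finite_trace central_diff)
  have "p - scaleC a \<xi> = 0"
  proof (rule orthogonal_orbit)
    fix g assume g: "g \<in> carrier G"
    \<comment> \<open>By \<open>pq1\<close> the first summand of \<open>chi\<close> is the coefficient of \<open>\<pi>\<close> at \<open>p\<close> and \<open>\<xi>\<close>.\<close>
    have "cinner (\<pi> (inv g) p) \<xi> = a * chi (inv g)"
      using a[of "inv g"] pq1[of "inv g"] g by (simp add: cinner_diff_right algebra_simps)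
    then show "cinner (p - scaleC a \<xi>) (\<pi> g \<xi>) = 0"
      using g by (simp add: cinner_algebra rep_adjoint chi_eq)
  qed
  then have p: "p = scaleC a \<xi>" by simp
  \<comment> \<open>Here \<open>\<pi> h (S v)\<close> is the value of the adjoint of \<open>A\<close> at \<open>\<pi> h \<xi>\<close>.\<close>
  have closable: "cinner y (\<pi> h \<xi>) = cinner x (\<pi> h (S v))" if "(x, y) \<in> Gr" "h \<in> carrier G" for x y h
  proof -
    have "Gr \<subseteq> {a. cinner (snd a) (\<pi> h \<xi>) = cinner (fst a) (\<pi> h (S v))}"
      unfolding Gr_def
    proof (rule closure_cspan_minimal)
      show "csubspace {a. cinner (snd a) (\<pi> h \<xi>) = cinner (fst a) (\<pi> h (S v))}"
        by (rule csubspaceI) (auto simp: cinner_algebra scaleC_prod_def)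
      have "cinner (\<pi> g v) (\<pi> h \<xi>) = cinner (\<pi> g \<xi>) (\<pi> h (S v))" if g: "g \<in> carrier G" for g
      proof -
        define k where "k = inv h \<otimes> g"
        have k: "k \<in> carrier G" using g \<open>h \<in> carrier G\<close> by (simp add: k_def)
        have "cinner (\<pi> k \<xi>) (S v) = cinner v (S (\<pi> k \<xi>))"
          using conj_cinner[of "S (\<pi> k \<xi>)" v] by (simp add: conj_conj)
        also have "\<dots> = cinner (\<pi> k v) \<xi>"
          using k by (simp add: conj_orbit rep_adjoint)
        finally show ?thesis
          using g \<open>h \<in> carrier G\<close> rep_adjoint[of "inv h" "\<pi> g v" \<xi>] rep_adjoint[of "inv h" "\<pi> g \<xi>" "S v"]
          by (simp add: k_def rep_mult)
      qed
      then show "(\<lambda>g. (\<pi> g \<xi>, \<pi> g v)) ` carrier G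
          \<subseteq> {a. cinner (snd a) (\<pi> h \<xi>) = cinner (fst a) (\<pi> h (S v))}"
        by auto
    qed (intro closed_Collect_eq continuous_intros)
    then show ?thesis using that by auto
  qed
  have "(\<xi>, v) \<in> Gr"
    using gen[of \<one>] by (simp add: rep_one)
  then have "(p, q) - scaleC a (\<xi>, v) \<in> Gr"
    using Gr pq by (intro complex_vector.subspace_diff complex_vector.subspace_scale)
  then have "(0, q - scaleC a v) \<in> Gr"
    by (simp add: p)
  then have "q - scaleC a v = 0"
    using closable by (intro orthogonal_orbit) simp
  then have q: "q = scaleC a v" by simp
  have eq: "(1 - a) * cinner \<xi> (\<pi> g \<xi>) = a * cinner v (\<pi> g v)" if "g \<in> carrier G" for g
    using orth[OF gen[OF that]] by (simp add: p q cinner_algebra algebra_simps)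
  have "a \<noteq> 0"
    using eq[of \<one>] by (auto simp: rep_one cinner_self)
  have "cinner (\<pi> g v) v = cnj ((1 - a) / a) * chi g" if "g \<in> carrier G" for g
  proof -
    have "cinner v (\<pi> g v) = (1 - a) / a * cinner \<xi> (\<pi> g \<xi>)"
      using eq[OF that] \<open>a \<noteq> 0\<close> by (simp add: field_simps)
    then have "cnj (cinner v (\<pi> g v)) = cnj ((1 - a) / a) * cnj (cinner \<xi> (\<pi> g \<xi>))"
      by (simp only: complex_cnj_mult)
    then show ?thesis
      using that by (simp only: cinner_commute[symmetric] chi_eq)
  qed
  then show ?thesis by blast
qed

text \<open>
  Every central vector has a state proportional to \<open>chi\<close>. Applied to \<open>v\<close>, \<open>v + \<xi>\<close> and
  \<open>v + \<i> \<xi>\<close> this gives, by polarisation, that the coefficient of \<open>\<pi>\<close> at \<open>v\<close> and \<open>\<xi>\<close> is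
  proportional to \<open>chi\<close> too, and the orbit of \<open>\<xi>\<close> is total.
\<close>

theorem central_vector_scalar:
  assumes indec: "indecomposable_character G T chi" and v: "central v"
  shows "\<exists>k. v = scaleC k \<xi>"
proof -
  note state = central_vector_state[OF indec]
  obtain c0 where c0: "\<And>g. g \<in> carrier G \<Longrightarrow> cinner (\<pi> g v) v = c0 * chi g"
    using state[OF v] by blast
  obtain c1 where c1: "\<And>g. g \<in> carrier G \<Longrightarrow> cinner (\<pi> g (v + \<xi>)) (v + \<xi>) = c1 * chi g"
    using state[OF central_add[OF v central_xi]] by blast
  obtain c2 where c2: "\<And>g. g \<in> carrier G \<Longrightarrow>
      cinner (\<pi> g (v + scaleC \<i> \<xi>)) (v + scaleC \<i> \<xi>) = c2 * chi g"
    using state[OF central_add[OF v central_scaleC[OF central_xi, of \<i>]]] by blast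
  define k where "k = ((c1 - c0 - 1) + \<i> * (c2 - c0 - 1)) / 2"
  have k: "cinner (\<pi> g v) \<xi> = k * chi g" if g: "g \<in> carrier G" for g
  proof -
    let ?A = "cinner (\<pi> g v) \<xi>" and ?B = "cinner (\<pi> g \<xi>) v"
    have "?A + ?B = (c1 - c0 - 1) * chi g"
      using c1[OF g] c0[OF g] g by (simp add: rep_add cinner_algebra chi_eq algebra_simps)
    moreover have "\<i> * ?B - \<i> * ?A = (c2 - c0 - 1) * chi g"
      using c2[OF g] c0[OF g] g
      by (simp add: rep_add rep_scaleC cinner_algebra chi_eq algebra_simps)
    then have "\<i> * (\<i> * ?B - \<i> * ?A) = \<i> * ((c2 - c0 - 1) * chi g)"
      by simp
    then have "?A - ?B = \<i> * (c2 - c0 - 1) * chi g"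
      by (simp add: algebra_simps)
    ultimately have "(?A + ?B) + (?A - ?B) = (c1 - c0 - 1) * chi g + \<i> * (c2 - c0 - 1) * chi g"
      by (simp only:)
    also have "\<dots> = 2 * k * chi g"
      by (simp add: k_def algebra_simps)
    finally show ?thesis by simp
  qed
  have "v - scaleC k \<xi> = 0"
  proof (rule orthogonal_orbit)
    fix g assume "g \<in> carrier G"
    then show "cinner (v - scaleC k \<xi>) (\<pi> g \<xi>) = 0"
      using k[of "inv g"] rep_adjoint[of "inv g" v \<xi>] rep_adjoint[of "inv g" \<xi> \<xi>]
      by (simp add: cinner_algebra chi_eq)
  qed
  then show ?thesis by (intro exI[of _ k]) simp
qed

end

section \<open>Spherical representations of groups split over an abelian normal subgroup\<close>

context tracial_gns_conjugation
begin

lemma right_rep_cinner: "g \<in> carrier G \<Longrightarrow> cinner (right_rep g x) (right_rep g y) = cinner x y"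
  by (simp add: right_rep_def conj_cinner rep_cinner)

lemma right_rep_continuous: "continuous_map T euclidean (\<lambda>g. right_rep g x)"
  using continuous_map_compose[OF rep_continuous, of euclidean S] conj_continuous
  by (simp add: right_rep_def o_def)

text \<open>
  Both actions are isometric, so strong continuity of the factors gives strong continuity of the
  product.
\<close>

lemma rep_right_rep_continuous:
  assumes T: "topspace T = carrier G" and s: "continuous_map T T s"
  shows "continuous_map T euclidean (\<lambda>g. \<pi> g (right_rep (s g) v))"
  unfolding continuous_map_atin
proof
  fix a assume a: "a \<in> topspace T"
  define w where "w = right_rep (s a) v"
  have "continuous_map T euclidean (\<lambda>g. right_rep (s g) v)"
    using continuous_map_compose[OF s right_rep_continuous] by (simp add: o_def)
  then have "((\<lambda>g. right_rep (s g) v) \<longlongrightarrow> w) (atin T a)"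
    using a by (simp add: continuous_map_atin w_def)
  then have "((\<lambda>g. norm (right_rep (s g) v - w)) \<longlongrightarrow> 0) (atin T a)"
    using LIM_zero tendsto_norm_zero by blast
  moreover have "\<forall>\<^sub>F g in atin T a. norm (\<pi> g (right_rep (s g) v) - \<pi> g w) \<le> norm (right_rep (s g) v - w)"
    unfolding eventually_atin using a openin_topspace[of T]
    by (intro disjI2 conjI[OF a] exI[of _ "topspace T"]) (auto simp: T norm_rep simp flip: rep_diff)
  ultimately have "((\<lambda>g. \<pi> g (right_rep (s g) v) - \<pi> g w) \<longlongrightarrow> 0) (atin T a)"
    by (rule Lim_null_comparison[rotated])
  moreover have "((\<lambda>g. \<pi> g w) \<longlongrightarrow> \<pi> a w) (atin T a)"
    using rep_continuous[of w] a by (simp add: continuous_map_atin)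
  ultimately have "((\<lambda>g. (\<pi> g (right_rep (s g) v) - \<pi> g w) + \<pi> g w) \<longlongrightarrow> 0 + \<pi> a w) (atin T a)"
    by (rule tendsto_add)
  then show "limitin euclidean (\<lambda>g. \<pi> g (right_rep (s g) v)) (\<pi> a (right_rep (s a) v)) (atin T a)"
    by (simp add: w_def)
qed

end

text \<open>
  A retraction \<open>s\<close> with abelian kernel presents \<open>G\<close> as a semidirect product of its kernel \<open>F\<close>
  and its fixed points \<open>K\<close>. The pair of \<open>g\<close> and \<open>s g\<close> acts by \<open>\<pi> g\<close> and the right action
  of \<open>s g\<close>.
\<close>

locale split_gns = tracial_gns_conjugation G T chi \<pi> \<xi> S
  for G (structure) and T :: "'g topology" and chi :: "'g \<Rightarrow> complex"
    and \<pi> :: "'g \<Rightarrow> 'h :: complex_hilbert \<Rightarrow> 'h" and \<xi> :: 'h and S :: "'h \<Rightarrow> 'h" +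
  fixes s :: "'g \<Rightarrow> 'g"
  assumes indecomposable: "indecomposable_character G T chi"
    and topspace: "topspace T = carrier G"
    and s_continuous: "continuous_map T T s"
    and s_hom: "s \<in> hom G G"
    and s_idem: "g \<in> carrier G \<Longrightarrow> s (s g) = s g"
    and kernel_commute: "\<lbrakk>g \<in> carrier G; h \<in> carrier G; s g = \<one>; s h = \<one>\<rbrakk> \<Longrightarrow> g \<otimes> h = h \<otimes> g"
begin

sublocale s: group_hom G G s
  by unfold_locales (rule s_hom)

definition F :: "'g set" where "F = {g \<in> carrier G. s g = \<one>}"
definition K :: "'g set" where "K = {g \<in> carrier G. s g = g}"
definition V :: "'h set" where "V = closure (cspan ((\<lambda>t. \<pi> t \<xi>) ` F))"
definition \<rho> :: "'g \<Rightarrow> 'h \<Rightarrow> 'h" where "\<rho> g x = \<pi> g (right_rep (s g) x)"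

lemma V_closed: "closed V" and V_csubspace: "csubspace V"
  by (simp_all add: V_def csubspace_closure_cspan)

lemma orbit_in_V: "t \<in> F \<Longrightarrow> \<pi> t \<xi> \<in> V"
  unfolding V_def by (intro subsetD[OF closure_cspan_superset] image_eqI[OF refl])

lemma xi_in_V: "\<xi> \<in> V"
  using orbit_in_V[of \<one>] by (simp add: F_def rep_one)

lemma \<rho>_bounded_clinear: "g \<in> carrier G \<Longrightarrow> bounded_clinear (\<rho> g)"
  using bounded_clinear_compose[OF rep_bounded_clinear right_rep_bounded_clinear]
  by (simp add: \<rho>_def[abs_def])

lemma \<rho>_mult: "\<lbrakk>g \<in> carrier G; h \<in> carrier G\<rbrakk> \<Longrightarrow> \<rho> (g \<otimes> h) x = \<rho> g (\<rho> h x)"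
  by (simp add: \<rho>_def rep_mult right_rep_mult right_rep_commute)

lemma \<rho>_one: "\<rho> \<one> x = x"
  by (simp add: \<rho>_def rep_one right_rep_one)

lemma \<rho>_adjoint: "g \<in> carrier G \<Longrightarrow> cinner (\<rho> g x) y = cinner x (\<rho> (inv g) y)"
  by (simp add: \<rho>_def rep_adjoint right_rep_adjoint right_rep_commute)

text \<open>
  On \<open>\<pi> u \<xi>\<close> with \<open>u\<close> in the kernel, \<open>\<rho> g\<close> replaces \<open>u\<close> by \<open>g \<otimes> u \<otimes> inv s g\<close>, which is in
  the kernel again.
\<close>

lemma \<rho>_V:
  assumes g: "g \<in> carrier G" and x: "x \<in> V"
  shows "\<rho> g x \<in> V"
proof (rule bounded_clinear_closure_cspan[OF \<rho>_bounded_clinear[OF g] V_closed V_csubspace])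
  show "x \<in> closure (cspan ((\<lambda>t. \<pi> t \<xi>) ` F))"
    using x by (simp only: V_def)
  fix y assume "y \<in> (\<lambda>t. \<pi> t \<xi>) ` F"
  then obtain u where u: "u \<in> carrier G" "s u = \<one>" "y = \<pi> u \<xi>"
    by (auto simp: F_def)
  have "g \<otimes> u \<otimes> inv s g \<in> F"
    using g u by (simp add: F_def s_idem)
  then show "\<rho> g y \<in> V"
    using orbit_in_V[of "g \<otimes> u \<otimes> inv s g"] g u
    by (simp add: \<rho>_def right_rep_orbit m_assoc flip: rep_mult)
qed

lemma \<rho>_kernel: "t \<in> F \<Longrightarrow> \<rho> t x = \<pi> t x"
  by (simp add: F_def \<rho>_def right_rep_one)

lemma \<rho>_K: "k \<in> K \<Longrightarrow> \<rho> k x = conjugation_rep k x"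
  by (simp add: K_def \<rho>_def)

lemma unitary_rep_\<rho>: "unitary_rep G T V \<rho>"
  unfolding unitary_rep_def unitary_on_def
proof (intro conjI ballI allI V_closed V_csubspace \<rho>_mult)
  show "continuous_map T euclidean (\<lambda>g. \<rho> g v)" for v
    unfolding \<rho>_def by (rule rep_right_rep_continuous[OF topspace s_continuous])
  fix g assume g: "g \<in> carrier G"
  show "\<rho> g (x + y) = \<rho> g x + \<rho> g y" "\<rho> g (scaleC c x) = scaleC c (\<rho> g x)" for x y c
    using bounded_clinearD[OF \<rho>_bounded_clinear[OF g]] by auto
  show "cinner (\<rho> g x) (\<rho> g y) = cinner x y" for x y
    using g by (simp add: \<rho>_def rep_cinner right_rep_cinner)
  show "\<rho> g ` V = V"
  proof
    show "\<rho> g ` V \<subseteq> V"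
      using \<rho>_V[OF g] by blast
    show "V \<subseteq> \<rho> g ` V"
    proof
      fix x assume "x \<in> V"
      moreover have "x = \<rho> g (\<rho> (inv g) x)"
        using g by (simp add: \<rho>_one flip: \<rho>_mult)
      ultimately show "x \<in> \<rho> g ` V"
        using \<rho>_V[of "inv g"] g by blast
    qed
  qed
qed

text \<open>
  An abelian kernel acts trivially by conjugation on the vectors that it generates from \<open>\<xi>\<close>.
\<close>

lemma kernel_conjugation_V:
  assumes t: "t \<in> F" and x: "x \<in> V"
  shows "conjugation_rep t x = x"
proof -
  have tG: "t \<in> carrier G" using t by (simp add: F_def)
  note bc = bounded_clinearD[OF conjugation_rep_bounded_clinear[OF tG]]
  have "V \<subseteq> {x. conjugation_rep t x = x}"
    unfolding V_def
  proof (rule closure_cspan_minimal)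
    show "closed {x. conjugation_rep t x = x}"
      by (rule closed_Collect_eq[OF bc(3) continuous_on_id])
    show "csubspace {x. conjugation_rep t x = x}"
      using bc(2)[of 0 0] by (intro csubspaceI) (auto simp: bc(1,2))
    have "t \<otimes> u \<otimes> inv t = u" if "u \<in> F" for u
      using that t kernel_commute[of t u] by (simp add: F_def m_assoc)
    then show "(\<lambda>t. \<pi> t \<xi>) ` F \<subseteq> {x. conjugation_rep t x = x}"
      using t by (auto simp: F_def conjugation_rep_orbit)
  qed
  then show ?thesis using x by blast
qed

text \<open>
  On \<open>V\<close> the kernel acts trivially by conjugation, and \<open>\<rho> k\<close> is conjugation by \<open>k\<close>. As \<open>F\<close>
  and \<open>K\<close> generate \<open>G\<close>, an invariant vector in \<open>V\<close> is central, hence a multiple of \<open>\<xi>\<close>.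
\<close>

lemma invariant_vectors_K: "invariant_vectors K V \<rho> = cspan {\<xi>}"
proof
  show "invariant_vectors K V \<rho> \<subseteq> cspan {\<xi>}"
  proof
    fix v assume "v \<in> invariant_vectors K V \<rho>"
    then have v: "v \<in> V" "\<And>k. k \<in> K \<Longrightarrow> conjugation_rep k v = v"
      by (auto simp: invariant_vectors_def \<rho>_K)
    have "conjugation_rep g v = v" if g: "g \<in> carrier G" for g
    proof -
      have F: "g \<otimes> inv s g \<in> F" and K: "s g \<in> K"
        using g by (simp_all add: F_def K_def s_idem)
      then have "conjugation_rep ((g \<otimes> inv s g) \<otimes> s g) v = v"
        using kernel_conjugation_V[OF F v(1)] v(2)[OF K] g
        by (subst conjugation_rep_mult) auto
      then show ?thesis
        using g by (simp add: m_assoc)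
    qed
    then have "central v"
      by (simp add: central_def)
    then show "v \<in> cspan {\<xi>}"
      using central_vector_scalar[OF indecomposable] by (auto simp: complex_vector.span_singleton)
  qed
  show "cspan {\<xi>} \<subseteq> invariant_vectors K V \<rho>"
    using complex_vector.subspace_scale[OF V_csubspace xi_in_V] central_scaleC[OF central_xi]
    by (auto simp: complex_vector.span_singleton invariant_vectors_def \<rho>_K central_def K_def)
qed

text \<open>
  The projection of \<open>\<xi>\<close> onto an invariant subspace is \<open>K\<close>-invariant, hence a multiple of \<open>\<xi>\<close>.
  If the multiple is nonzero, the subspace contains the cyclic vector \<open>\<xi>\<close>; otherwise it is
  orthogonal to the orbit of \<open>\<xi>\<close> under the kernel.
\<close>

lemma irreducible_\<rho>: "irreducible_rep G V \<rho>"
  unfolding irreducible_rep_def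
proof (intro conjI allI impI)
  have "\<xi> \<noteq> 0" using norm_xi by force
  then show "V \<noteq> {0}" using xi_in_V by blast
next
  fix W assume "closed W \<and> csubspace W \<and> W \<subseteq> V \<and> (\<forall>g\<in>carrier G. \<rho> g ` W \<subseteq> W)"
  then have W: "closed W" "csubspace W" "W \<subseteq> V" and inv: "\<And>g w. g \<in> carrier G \<Longrightarrow> w \<in> W \<Longrightarrow> \<rho> g w \<in> W"
    by blast+
  obtain p where p: "p \<in> W" "\<And>w. w \<in> W \<Longrightarrow> cinner (\<xi> - p) w = 0"
    using projection_exists[OF W(1,2), of \<xi>] by blast
  have "\<rho> k p = p" if k: "k \<in> K" for k
  proof (rule fixed_projection[OF W(2) p])
    have kG: "k \<in> carrier G" using k by (simp add: K_def)
    show "cinner (\<rho> k y) z = cinner y (\<rho> (inv k) z)" for y z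
      by (rule \<rho>_adjoint[OF kG])
    show "\<rho> k w \<in> W" "\<rho> (inv k) w \<in> W" if "w \<in> W" for w
      using inv that kG by simp_all
    show "\<rho> k \<xi> = \<xi>"
      using central_xi kG by (simp add: \<rho>_K[OF k] central_def)
  qed
  then have "p \<in> cspan {\<xi>}"
    using p(1) W(3) by (auto simp: invariant_vectors_def simp flip: invariant_vectors_K)
  then obtain c where c: "p = scaleC c \<xi>"
    by (auto simp: complex_vector.span_singleton)
  show "W = {0} \<or> W = V"
  proof (cases "c = 0")
    case False
    then have "\<xi> \<in> W"
      using complex_vector.subspace_scale[OF W(2) p(1), of "inverse c"]
      by (simp add: c scaleC_scaleC scaleC_one)
    then have "\<pi> t \<xi> \<in> W" if "t \<in> F" for t
      using inv[of t \<xi>] that \<rho>_kernel[OF that, of \<xi>] by (simp add: F_def)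
    then have "V \<subseteq> W"
      unfolding V_def by (intro closure_cspan_minimal W) auto
    then show ?thesis using W(3) by blast
  next
    case True
    have "w = 0" if w: "w \<in> W" for w
    proof -
      have "cinner x w = 0" if "x \<in> V" for x
      proof -
        have "V \<subseteq> {x. cinner x w = 0}"
          unfolding V_def
        proof (rule closure_cspan_minimal)
          show "closed {x. cinner x w = 0}"
            by (intro closed_Collect_eq continuous_intros)
          show "csubspace {x. cinner x w = 0}"
            by (rule csubspaceI) (simp_all add: cinner_algebra)
          have "cinner (\<pi> t \<xi>) w = 0" if t: "t \<in> F" for t
          proof -
            have "cinner (\<pi> t \<xi>) w = cinner \<xi> (\<rho> (inv t) w)"
              using t \<rho>_adjoint[of t \<xi> w] by (simp add: \<rho>_kernel F_def)
            then show ?thesis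
              using p(2)[OF inv[OF _ w, of "inv t"]] t True by (simp add: c F_def)
          qed
          then show "(\<lambda>t. \<pi> t \<xi>) ` F \<subseteq> {x. cinner x w = 0}"
            by auto
        qed
        then show ?thesis using that by blast
      qed
      then have "cinner w w = 0" using w W(3) by blast
      then show ?thesis by (rule cinner_self_eq_0)
    qed
    then show ?thesis
      using complex_vector.subspace_0[OF W(2)] by blast
  qed
qed

theorem spherical_rep_\<rho>: "spherical_rep G T K V \<rho>"
proof -
  have "\<xi> \<noteq> 0" using norm_xi by force
  then have "\<not> complex_vector.dependent {\<xi>}"
    by (simp add: complex_vector.dependent_single)
  then have "cdim (cspan {\<xi>}) = 1"
    using complex_vector.dim_eq_card_independent[of "{\<xi>}"] by simp
  then show ?thesis
    by (simp add: spherical_rep_def unitary_rep_\<rho> irreducible_\<rho> invariant_vectors_K)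
qed

text \<open>
  A unit invariant vector is \<open>\<xi>\<close> up to a phase, and on the kernel \<open>\<rho>\<close> is \<open>\<pi>\<close>.
\<close>

theorem spherical_function_\<rho>:
  assumes "is_spherical_function K V \<rho> \<phi>" "t \<in> F"
  shows "\<phi> t = chi t"
proof -
  obtain \<eta> where \<eta>: "\<eta> \<in> cspan {\<xi>}" "norm \<eta> = 1" "\<phi> = (\<lambda>g. cinner (\<rho> g \<eta>) \<eta>)"
    using assms(1) by (auto simp: is_spherical_function_def invariant_vectors_K)
  then obtain c where c: "\<eta> = scaleC c \<xi>"
    by (auto simp: complex_vector.span_singleton)
  have "c * cnj c = 1"
    using \<eta>(2) by (simp add: c norm_scaleC flip: complex_norm_square)
  moreover have "\<phi> t = (c * cnj c) * chi t"
    using assms(2) by (simp add: \<eta>(3) c \<rho>_kernel F_def rep_scaleC cinner_scaleC_left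
        cinner_scaleC_right chi_eq)
  ultimately show ?thesis by simp
qed

end

section \<open>The permutation part on the inductive limit\<close>

definition perm_part :: "tperm \<Rightarrow> tperm" where
  "perm_part g = ((\<lambda>x. 1), snd g)"

lemma perm_part_carrier:
  assumes "\<forall>i\<ge>1. n i > 1" "g \<in> carrier (G_lim n)"
  shows "perm_part g \<in> carrier (G_lim n)"
  using G_lim_S_lim[OF assms(1), of "fst g" "snd g"] assms(2) by (simp add: perm_part_def S_lim_def)

lemma perm_part_hom:
  assumes "\<forall>i\<ge>1. n i > 1"
  shows "perm_part \<in> hom (G_lim n) (G_lim n)"
  using perm_part_carrier[OF assms]
  by (intro homI) (auto simp: perm_part_def G_lim_def split: prod.splits)

lemma G_lim_one: "\<one>\<^bsub>G_lim n\<^esub> = ((\<lambda>x. 1), id)"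
  and G_lim_mult: "g \<otimes>\<^bsub>G_lim n\<^esub> h = ((\<lambda>x. fst g x * fst h (inv_into UNIV (snd g) x)), snd g \<circ> snd h)"
  by (simp_all add: G_lim_def case_prod_beta)

lemma F_lim_eq: "F_lim n = {g \<in> carrier (G_lim n). perm_part g = \<one>\<^bsub>G_lim n\<^esub>}"
  by (auto simp: F_lim_def perm_part_def G_lim_one)

lemma S_lim_eq: "S_lim n = {g \<in> carrier (G_lim n). perm_part g = g}"
  by (auto simp: S_lim_def perm_part_def)

lemma perm_part_limit_embed:
  assumes "N \<ge> 1"
  shows "perm_part (limit_embed N (t, \<sigma>)) = limit_embed N ((\<lambda>x\<in>{1..N}. 1), \<sigma>)"
  using brem_range[OF assms] by (auto simp: perm_part_def limit_embed_eq ext_fun_def fun_eq_iff)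

text \<open>
  On each finite level the permutation part depends on the discrete factor only, so the
  preimage of any set whatsoever is open.
\<close>

lemma perm_part_continuous:
  assumes n: "\<forall>i\<ge>1. n i > 1"
  shows "continuous_map (G_lim_top n) (G_lim_top n) perm_part"
  unfolding continuous_map topspace_G_lim_top
proof (intro conjI allI impI image_subsetI perm_part_carrier[OF n])
  fix U
  show "openin (G_lim_top n) {g \<in> carrier (G_lim n). perm_part g \<in> U}"
    unfolding openin_G_lim_top
  proof (intro conjI allI impI)
    fix k :: nat assume k: "k \<ge> 1"
    define N where "N = Nprod n k"
    have N: "N \<ge> 1" using Nprod_ge_1[OF n] by (simp add: N_def)
    let ?X = "product_topology (\<lambda>_. top_of_set (sphere 0 1)) {1..N}"
    let ?A = "{\<sigma>. \<sigma> permutes {1..N} \<and> limit_embed N ((\<lambda>x\<in>{1..N}. 1 :: complex), \<sigma>) \<in> U}"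
    have "{g \<in> carrier (G_fin N). limit_embed N g \<in> {g \<in> carrier (G_lim n). perm_part g \<in> U}}
        = topspace ?X \<times> ?A"
      using limit_embed_carrier[OF k, of _ n] N
      by (auto simp: N_def[symmetric] perm_part_limit_embed G_fin_def)
    moreover have "openin (G_fin_top N) (topspace ?X \<times> ?A)"
      unfolding G_fin_top_def openin_prod_Times_iff by (intro disjI2 conjI openin_topspace) auto
    ultimately show "openin (G_fin_top (Nprod n k))
        {g \<in> carrier (G_fin (Nprod n k)). limit_embed (Nprod n k) g \<in> {g \<in> carrier (G_lim n). perm_part g \<in> U}}"
      by (simp add: N_def)
  qed auto
qed

theorem proposition1p2:
  fixes n :: "nat \<Rightarrow> nat"
    and chi :: "tperm \<Rightarrow> complex"
    and \<pi> :: "tperm \<Rightarrow> 'h :: complex_hilbert \<Rightarrow> 'h"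
    and \<xi> :: 'h
  assumes "\<forall>k\<ge>1. n k > 1"
    and "indecomposable_character (G_lim n) (G_lim_top n) chi"
    and "gns_triple (G_lim n) (G_lim_top n) chi \<pi> \<xi>"
  shows "let \<rho> = two_sided_rep (G_lim n) \<pi> \<xi> \<circ> Gamma_emb;
             V = closure (cspan ((\<lambda>t. \<pi> t \<xi>) ` F_lim n))
         in spherical_rep (G_lim n) (G_lim_top n) (S_lim n) V \<rho> \<and>
            (\<forall>\<phi>. is_spherical_function (S_lim n) V \<rho> \<phi> \<longrightarrow> (\<forall>t\<in>F_lim n. \<phi> t = chi t))"
proof -
  let ?S = "gns_involution (G_lim n) \<pi> \<xi>"
  interpret group "G_lim n"
    by (rule group_G_lim[OF assms(1)])
  interpret tracial_gns "G_lim n" "G_lim_top n" chi \<pi> \<xi>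
    using assms(2,3) by unfold_locales (auto simp: indecomposable_character_def character_def)
  interpret tracial_gns_conjugation "G_lim n" "G_lim_top n" chi \<pi> \<xi> ?S
    by (rule gns_involution_conjugation)
  interpret split_gns "G_lim n" "G_lim_top n" chi \<pi> \<xi> ?S perm_part
  proof unfold_locales
    show "indecomposable_character (G_lim n) (G_lim_top n) chi" by (rule assms(2))
    show "topspace (G_lim_top n) = carrier (G_lim n)" by (rule topspace_G_lim_top)
    show "continuous_map (G_lim_top n) (G_lim_top n) perm_part" by (rule perm_part_continuous[OF assms(1)])
    show "perm_part \<in> hom (G_lim n) (G_lim n)" by (rule perm_part_hom[OF assms(1)])
  qed (auto simp: perm_part_def G_lim_one G_lim_mult mult.commute)
  have "two_sided_rep (G_lim n) \<pi> \<xi> \<circ> Gamma_emb = \<rho>"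
    by (auto simp: fun_eq_iff two_sided_rep_def Gamma_emb_def \<rho>_def right_rep_def perm_part_def Let_def)
  moreover have "F_lim n = F" "S_lim n = K"
    by (simp_all add: F_lim_eq S_lim_eq F_def K_def)
  ultimately show ?thesis
    using spherical_rep_\<rho> spherical_function_\<rho> by (simp add: V_def Let_def)
qed

end
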